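(* Let $n\ge1$ be an integer with $\gcd(3,n)=1$. The (one-variable) Jones polynomial of the weaving knot $W(3,n)$ is $$V_{W(3,n)}(t) = t^{-n-1}\Bigl( (1+t)^2\, C_{n,0}(t) + (1+t)\,\bigl(C_{n,1}(t)+C_{n,2}(t)\bigr)\,t^2 + \bigl(C_{n,12}(t)+C_{n,21}(t)\bigr)\,t^4 \Bigr),$$ where the $C_{n,*}(t)$ are the polynomials $C_{n,*}(q)$ evaluated at $q=t$.
   Context: $W(3,n)$ is the closure of the three-strand braid $(\sigma_1\sigma_2^{-1})^n$; it is a knot when $\gcd(3,n)=1$. The polynomials $C_{n,*}$ are defined as follows. Let $K=\mathbf{C}(q,z)$ be the field of rational functions in indeterminates $q,z$. For $N\ge1$ the Hecke algebra $H_{N+1}$ is the associative unital $K$-algebra on generators $T_1,\dots,T_N$ with relations $T_iT_j=T_jT_i$ for $|i-j|\ge2$, $T_iT_{i+1}T_i=T_{i+1}T_iT_{i+1}$, and $T_i^2=(q-1)T_i+q$. In $H_3$, with basis $\{1,T_1,T_2,T_1T_2,T_2T_1,T_1T_2T_1\}$, the polynomials $C_{n,*}\in\mathbf{Z}[q]$ ($n\ge1$) are defined by $$(T_1T_2^{-1})^n = q^{-n}\bigl(C_{n,0}+C_{n,1}T_1+C_{n,2}T_2+C_{n,12}T_1T_2+C_{n,21}T_2T_1+C_{n,121}T_1T_2T_1\bigr).$$ The Jones polynomial is constructed as follows. There is a family of trace functions $\mathrm{Tr}\colon H_{N+1}\to K$, compatible with the inclusions $H_N\to H_{N+1}$, which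 are $K$-linear and satisfy $\mathrm{Tr}(1)=1$, $\mathrm{Tr}(ab)=\mathrm{Tr}(ba)$, and $\mathrm{Tr}(aT_Nb)=z\,\mathrm{Tr}(ab)$ for $a,b\in H_N$. Let $\rho\colon B_{N+1}\to H_{N+1}$ be the homomorphism from the braid group to the units with $\rho(\sigma_i)=T_i$, and put $w=1-q+z$. For the closure of a braid $\alpha\in B_{N+1}$ with exponent sum $e(\alpha)$, put $$V_\alpha(q,z)=\Bigl(\frac1z\Bigr)^{(N+e(\alpha))/2}\Bigl(\frac{q}{w}\Bigr)^{(N-e(\alpha))/2}\mathrm{Tr}\bigl(\rho(\alpha)\bigr).$$ The one-variable Jones polynomial of the closure of $\alpha$ is obtained from $V_\alpha(q,z)$ by substituting $q=t$, $z=\frac{t^2}{1+t}$, $w=\frac{1}{1+t}$. *)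

theory Defs
  imports
    Complex_Main
    "HOL-Library.Poly_Mapping"
    "HOL-Computational_Algebra.Polynomial"
    "HOL-Computational_Algebra.Fraction_Field"
    "HOL-Algebra.QuotRing"
begin

section \<open>The coefficient field $K = \mathbf{C}(q,z)$\<close>

type_synonym qz_field = "complex poly poly fract"

text \<open>The inner polynomial variable is $q$, the outer one is $z$.\<close>

definition K_q :: qz_field where "K_q = Fraction_Field.Fract [:[:0, 1:]:] 1"
definition K_z :: qz_field where "K_z = Fraction_Field.Fract [:0, 1:] 1"
definition K_w :: qz_field where "K_w = 1 - K_q + K_z"

definition int_poly_at :: "int poly \<Rightarrow> 'a::comm_ring_1 \<Rightarrow> 'a" where
  "int_poly_at p x = poly (map_poly of_int p) x"

section \<open>Hecke algebras\<close>

text \<open>Words form the free monoid, written additively because the convolution product of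
  \<^type>\<open>poly_mapping\<close> is indexed by \<^class>\<open>monoid_add\<close>.\<close>

datatype word = Word (letters: "nat list")

instantiation word :: monoid_add
begin
definition zero_word :: word where "0 = Word []"
definition plus_word :: "word \<Rightarrow> word \<Rightarrow> word" where "u + v = Word (letters u @ letters v)"
instance by standard (auto simp: zero_word_def plus_word_def)
end

type_synonym free_elt = "word \<Rightarrow>\<^sub>0 qz_field"

definition K_const :: "qz_field \<Rightarrow> free_elt" where "K_const c = Poly_Mapping.single 0 c"
definition free_gen :: "nat \<Rightarrow> free_elt" where "free_gen i = Poly_Mapping.single (Word [i]) 1"

text \<open>Throughout, \<open>m\<close> is the number of strands, so that \<open>hecke m\<close> is $H_m$, with generators
  $T_1,\dots,T_{m-1}$.\<close>

definition free_alg :: "nat \<Rightarrow> free_elt ring" where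
  "free_alg m =
     \<lparr>carrier = {x. \<forall>u \<in> Poly_Mapping.keys x. set (letters u) \<subseteq> {1..<m}},
      mult = (*), one = 1, zero = 0, add = (+)\<rparr>"

definition hecke_relators :: "nat \<Rightarrow> free_elt set" where
  "hecke_relators m =
     {free_gen i * free_gen j - free_gen j * free_gen i | i j.
        i \<in> {1..<m} \<and> j \<in> {1..<m} \<and> i + 2 \<le> j}
   \<union> {free_gen i * free_gen (i + 1) * free_gen i - free_gen (i + 1) * free_gen i * free_gen (i + 1) | i.
        i \<in> {1..<m} \<and> i + 1 \<in> {1..<m}}
   \<union> {free_gen i * free_gen i - (K_const (K_q - 1) * free_gen i + K_const K_q) | i. i \<in> {1..<m}}"

definition hecke_ideal :: "nat \<Rightarrow> free_elt set" where
  "hecke_ideal m = Idl\<^bsub>free_alg m\<^esub> (hecke_relators m)"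

definition hecke :: "nat \<Rightarrow> free_elt set ring" where
  "hecke m = free_alg m Quot hecke_ideal m"

definition hecke_of :: "nat \<Rightarrow> free_elt \<Rightarrow> free_elt set" where
  "hecke_of m x = hecke_ideal m +>\<^bsub>free_alg m\<^esub> x"

definition hT :: "nat \<Rightarrow> nat \<Rightarrow> free_elt set" where "hT m i = hecke_of m (free_gen i)"

definition hscale :: "nat \<Rightarrow> qz_field \<Rightarrow> free_elt set \<Rightarrow> free_elt set" where
  "hscale m c X = hecke_of m (K_const c) \<otimes>\<^bsub>hecke m\<^esub> X"

text \<open>The canonical map $H_m \to H_{m+1}$: it sends the coset of \<open>x\<close> modulo
  \<open>hecke_ideal m\<close> to the coset of \<open>x\<close> modulo \<open>hecke_ideal (m + 1)\<close>.\<close>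

definition hecke_incl :: "nat \<Rightarrow> free_elt set \<Rightarrow> free_elt set" where
  "hecke_incl m X = hecke_ideal (m + 1) <+>\<^bsub>free_alg (m + 1)\<^esub> X"

lemma ring_free_alg: "ring (free_alg m)"
proof -
  have sum: "x + y \<in> carrier (free_alg m)"
    if "x \<in> carrier (free_alg m)" "y \<in> carrier (free_alg m)" for x y
    using that Poly_Mapping.keys_add[of x y] by (auto simp: free_alg_def subset_iff)
  have prod: "x * y \<in> carrier (free_alg m)"
    if "x \<in> carrier (free_alg m)" "y \<in> carrier (free_alg m)" for x y
    using that Poly_Mapping.keys_mult[of x y] by (fastforce simp: free_alg_def plus_word_def)
  have neg: "- x \<in> carrier (free_alg m)" if "x \<in> carrier (free_alg m)" for x
    using that by (simp add: free_alg_def)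
  have one: "1 \<in> carrier (free_alg m)"
    by (simp add: free_alg_def zero_word_def)
  have zero: "0 \<in> carrier (free_alg m)"
    by (simp add: free_alg_def)
  have ops: "mult (free_alg m) = (*)" "add (free_alg m) = (+)"
    "one (free_alg m) = 1" "zero (free_alg m) = 0"
    by (simp_all add: free_alg_def)
  show ?thesis
  proof (rule ringI)
    show "abelian_group (free_alg m)"
    proof (rule abelian_groupI)
      fix x assume "x \<in> carrier (free_alg m)"
      then show "\<exists>y\<in>carrier (free_alg m). y \<oplus>\<^bsub>free_alg m\<^esub> x = \<zero>\<^bsub>free_alg m\<^esub>"
        using neg by (intro bexI[of _ "- x"]) (auto simp: ops)
    qed (auto simp: ops sum zero add_ac)
    show "Group.monoid (free_alg m)"
      by (rule Group.monoidI) (auto simp: ops prod one mult.assoc)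
  qed (auto simp: ops algebra_simps)
qed

lemma hecke_relators_carrier: "hecke_relators m \<subseteq> carrier (free_alg m)"
proof -
  interpret F: ring "free_alg m" by (rule ring_free_alg)
  have ops: "mult (free_alg m) = (*)" "add (free_alg m) = (+)"
    by (simp_all add: free_alg_def)
  have g: "free_gen i \<in> carrier (free_alg m)" if "i \<in> {1..<m}" for i
    using that by (simp add: free_gen_def free_alg_def)
  have c: "K_const a \<in> carrier (free_alg m)" for a
    by (simp add: K_const_def free_alg_def zero_word_def)
  have sum: "x + y \<in> carrier (free_alg m)"
    if "x \<in> carrier (free_alg m)" "y \<in> carrier (free_alg m)" for x y
    using F.a_closed[OF that] by (simp add: ops)
  have prod: "x * y \<in> carrier (free_alg m)"
    if "x \<in> carrier (free_alg m)" "y \<in> carrier (free_alg m)" for x y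
    using F.m_closed[OF that] by (simp add: ops)
  have neg: "- x \<in> carrier (free_alg m)" if "x \<in> carrier (free_alg m)" for x
    using that by (simp add: free_alg_def)
  have diff: "x - y \<in> carrier (free_alg m)"
    if "x \<in> carrier (free_alg m)" "y \<in> carrier (free_alg m)" for x y
    using sum[OF that(1) neg[OF that(2)]] by simp
  show ?thesis
    unfolding hecke_relators_def by (auto intro!: diff prod sum g c)
qed

lemma ideal_hecke_ideal: "ideal (hecke_ideal m) (free_alg m)"
  unfolding hecke_ideal_def
  by (rule ring.genideal_ideal[OF ring_free_alg hecke_relators_carrier])

lemma ring_hecke: "ring (hecke m)"
  unfolding hecke_def by (rule ideal.quotient_is_ring[OF ideal_hecke_ideal])

section \<open>The polynomials $C_{n,*}$\<close>

datatype H3_basis = B0 | B1 | B2 | B12 | B21 | B121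

primrec H3_elt :: "H3_basis \<Rightarrow> free_elt set" where
  "H3_elt B0 = \<one>\<^bsub>hecke 3\<^esub>"
| "H3_elt B1 = hT 3 1"
| "H3_elt B2 = hT 3 2"
| "H3_elt B12 = hT 3 1 \<otimes>\<^bsub>hecke 3\<^esub> hT 3 2"
| "H3_elt B21 = hT 3 2 \<otimes>\<^bsub>hecke 3\<^esub> hT 3 1"
| "H3_elt B121 = hT 3 1 \<otimes>\<^bsub>hecke 3\<^esub> hT 3 2 \<otimes>\<^bsub>hecke 3\<^esub> hT 3 1"

definition H3_comb :: "(H3_basis \<Rightarrow> qz_field) \<Rightarrow> free_elt set" where
  "H3_comb c =
     hscale 3 (c B0) (H3_elt B0) \<oplus>\<^bsub>hecke 3\<^esub> hscale 3 (c B1) (H3_elt B1)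
     \<oplus>\<^bsub>hecke 3\<^esub> hscale 3 (c B2) (H3_elt B2) \<oplus>\<^bsub>hecke 3\<^esub> hscale 3 (c B12) (H3_elt B12)
     \<oplus>\<^bsub>hecke 3\<^esub> hscale 3 (c B21) (H3_elt B21) \<oplus>\<^bsub>hecke 3\<^esub> hscale 3 (c B121) (H3_elt B121)"

definition weaving_C :: "nat \<Rightarrow> H3_basis \<Rightarrow> int poly" where
  "weaving_C n =
     (THE C. (hT 3 1 \<otimes>\<^bsub>hecke 3\<^esub> inv\<^bsub>hecke 3\<^esub> hT 3 2) [^]\<^bsub>hecke 3\<^esub> n
             = hscale 3 (K_q powi (- int n)) (H3_comb (\<lambda>b. int_poly_at (C b) K_q)))"

section \<open>Braid groups and their Hecke algebra representation\<close>

datatype braid_letter = Sig nat | SigInv nat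

primrec strand :: "braid_letter \<Rightarrow> nat" where
  "strand (Sig i) = i"
| "strand (SigInv i) = i"

definition braid_words :: "nat \<Rightarrow> braid_letter list set" where
  "braid_words m = {u. strand ` set u \<subseteq> {1..<m}}"

inductive braid_step :: "nat \<Rightarrow> braid_letter list \<Rightarrow> braid_letter list \<Rightarrow> bool" for m where
  cancel_right: "i \<in> {1..<m} \<Longrightarrow> braid_step m (x @ [Sig i, SigInv i] @ y) (x @ y)"
| cancel_left: "i \<in> {1..<m} \<Longrightarrow> braid_step m (x @ [SigInv i, Sig i] @ y) (x @ y)"
| far_commute: "i \<in> {1..<m} \<Longrightarrow> j \<in> {1..<m} \<Longrightarrow> i + 2 \<le> j \<Longrightarrow>
    braid_step m (x @ [Sig i, Sig j] @ y) (x @ [Sig j, Sig i] @ y)"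
| braid_rel: "i \<in> {1..<m} \<Longrightarrow> i + 1 \<in> {1..<m} \<Longrightarrow>
    braid_step m (x @ [Sig i, Sig (i + 1), Sig i] @ y) (x @ [Sig (i + 1), Sig i, Sig (i + 1)] @ y)"

definition braid_eq :: "nat \<Rightarrow> (braid_letter list \<times> braid_letter list) set" where
  "braid_eq m = {(u, v). u \<in> braid_words m \<and> v \<in> braid_words m \<and> equivclp (braid_step m) u v}"

definition braid_group :: "nat \<Rightarrow> braid_letter list set monoid" where
  "braid_group m =
     \<lparr>carrier = braid_words m // braid_eq m,
      mult = (\<lambda>A B. \<Union>a\<in>A. \<Union>b\<in>B. braid_eq m `` {a @ b}),
      one = braid_eq m `` {[]}\<rparr>"

definition braid_gen :: "nat \<Rightarrow> nat \<Rightarrow> braid_letter list set" where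
  "braid_gen m i = braid_eq m `` {[Sig i]}"

primrec letter_rep :: "nat \<Rightarrow> braid_letter \<Rightarrow> free_elt set" where
  "letter_rep m (Sig i) = hT m i"
| "letter_rep m (SigInv i) = inv\<^bsub>hecke m\<^esub> hT m i"

primrec word_rep :: "nat \<Rightarrow> braid_letter list \<Rightarrow> free_elt set" where
  "word_rep m [] = \<one>\<^bsub>hecke m\<^esub>"
| "word_rep m (a # u) = letter_rep m a \<otimes>\<^bsub>hecke m\<^esub> word_rep m u"

primrec letter_exponent :: "braid_letter \<Rightarrow> int" where
  "letter_exponent (Sig i) = 1"
| "letter_exponent (SigInv i) = -1"

text \<open>\<^const>\<open>the_elem\<close> picks the common value on all words representing the braid.\<close>

definition braid_rep :: "nat \<Rightarrow> braid_letter list set \<Rightarrow> free_elt set" where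
  "braid_rep m \<alpha> = the_elem (word_rep m ` \<alpha>)"

definition exponent_sum :: "braid_letter list set \<Rightarrow> int" where
  "exponent_sum \<alpha> = the_elem ((\<lambda>u. sum_list (map letter_exponent u)) ` \<alpha>)"

text \<open>The 3-braid whose closure is $W(3,n)$.\<close>

definition weaving_braid :: "nat \<Rightarrow> braid_letter list set" where
  "weaving_braid n =
     (braid_gen 3 1 \<otimes>\<^bsub>braid_group 3\<^esub> inv\<^bsub>braid_group 3\<^esub> braid_gen 3 2) [^]\<^bsub>braid_group 3\<^esub> n"

section \<open>Traces and the Jones polynomial\<close>

text \<open>A compatible family of traces \<open>Tr m\<close> on $H_m$, $m \ge 1$. These conditions determine
  the values of \<open>Tr m\<close> on $H_m$; such a family exists by a theorem of Ocneanu.\<close>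

definition hecke_trace :: "(nat \<Rightarrow> free_elt set \<Rightarrow> qz_field) \<Rightarrow> bool" where
  "hecke_trace Tr \<longleftrightarrow>
     (\<forall>m\<ge>1.
        (\<forall>a\<in>carrier (hecke m). \<forall>b\<in>carrier (hecke m). Tr m (a \<oplus>\<^bsub>hecke m\<^esub> b) = Tr m a + Tr m b)
      \<and> (\<forall>c. \<forall>a\<in>carrier (hecke m). Tr m (hscale m c a) = c * Tr m a)
      \<and> Tr m \<one>\<^bsub>hecke m\<^esub> = 1
      \<and> (\<forall>a\<in>carrier (hecke m). \<forall>b\<in>carrier (hecke m).
           Tr m (a \<otimes>\<^bsub>hecke m\<^esub> b) = Tr m (b \<otimes>\<^bsub>hecke m\<^esub> a))
      \<and> (\<forall>a\<in>carrier (hecke m). Tr (m + 1) (hecke_incl m a) = Tr m a)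
      \<and> (\<forall>a\<in>carrier (hecke m). \<forall>b\<in>carrier (hecke m).
           Tr (m + 1) (hecke_incl m a \<otimes>\<^bsub>hecke (m + 1)\<^esub> hT (m + 1) m
                       \<otimes>\<^bsub>hecke (m + 1)\<^esub> hecke_incl m b)
           = K_z * Tr m (a \<otimes>\<^bsub>hecke m\<^esub> b)))"

text \<open>Here $m = N + 1$. The exponents $(N \pm e(\alpha))/2$ are integers exactly when the closure
  of the braid has an odd number of components, in particular for every knot; otherwise
  $V_\alpha$ involves square roots, lies outside $K$, and is left unspecified.\<close>

definition V_braid ::
  "(nat \<Rightarrow> free_elt set \<Rightarrow> qz_field) \<Rightarrow> nat \<Rightarrow> braid_letter list set \<Rightarrow> qz_field" where
  "V_braid Tr m \<alpha> =
     (let N = int m - 1; e = exponent_sum \<alpha> in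
      if even (N + e)
      then (1 / K_z) powi ((N + e) div 2) * (K_q / K_w) powi ((N - e) div 2) * Tr m (braid_rep m \<alpha>)
      else undefined)"

definition t_var :: "complex poly fract" where "t_var = Fraction_Field.Fract [:0, 1:] 1"

definition qz_poly_subst ::
  "complex poly fract \<Rightarrow> complex poly fract \<Rightarrow> complex poly poly \<Rightarrow> complex poly fract" where
  "qz_poly_subst x y p =
     poly (map_poly (\<lambda>c. poly (map_poly (\<lambda>a. Fraction_Field.Fract [:a:] 1) c) x) p) y"

text \<open>Substitution of $q = x$, $z = y$ in a rational function that has a representation whose
  denominator does not vanish under the substitution.\<close>

definition qz_subst ::
  "complex poly fract \<Rightarrow> complex poly fract \<Rightarrow> qz_field \<Rightarrow> complex poly fract" where
  "qz_subst x y f =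
     (THE r. \<exists>a b. qz_poly_subst x y b \<noteq> 0 \<and> f = Fraction_Field.Fract a b
                  \<and> r = qz_poly_subst x y a / qz_poly_subst x y b)"

text \<open>Since $w = 1 - q + z$, substituting $q = t$ and $z = t^2/(1+t)$ entails $w = 1/(1+t)$.\<close>

definition jones_closure ::
  "(nat \<Rightarrow> free_elt set \<Rightarrow> qz_field) \<Rightarrow> nat \<Rightarrow> braid_letter list set \<Rightarrow> complex poly fract" where
  "jones_closure Tr m \<alpha> = qz_subst t_var (t_var ^ 2 / (1 + t_var)) (V_braid Tr m \<alpha>)"

end

theory Submission
  imports Defs
begin

text \<open>In $H_3$ one has $T_2^{-1} = q^{-1}(T_2 - (q-1))$, so the coefficients of $(T_1T_2^{-1})^n$
  satisfy a recursion, which keeps the coefficient of $T_1T_2T_1$ zero. The other five basis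
  elements have trace $1$, $z$, $z$, $z^2$, $z^2$ by the Markov property, and since the exponent sum
  vanishes, the normalising factor is $(1/z)(q/w)$, which becomes $(1+t)^2/t$.
  That the $C_{n,*}$ are well defined rests on the linear independence of the six basis elements;
  it follows from the left regular representation of $H_3$ on $K^6$.\<close>

section \<open>Computing in the Hecke algebras\<close>

text \<open>The coefficient of T_1 T_2 T_1 vanishes for a structural reason. Put x = T_1 T_2^{-1}.
  Then T_1 T_2 - (q-1) T_1 = q x and T_2 T_1 - (q-1) T_2 = q x^{-1}, and x^2 = ((q-1)^2 / q) (1 - x)
  + x^{-1} in H_3. So the span of 1, x, x^{-1} is stable under multiplication by x and never
  involves T_1 T_2 T_1; multiplying a + b q x + d q x^{-1} by q x gives the recursion of
  \<open>weaving_coeff\<close>.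

  Identities in a quotient by generators and relations call for two kinds of argument. That two
  elements agree is certified by writing their difference as an explicit combination of relators;
  that they differ needs a model. The operators \<open>mulT1\<close> and \<open>mulT2\<close> serve
  both purposes: they describe left multiplication modulo the ideal, and they satisfy the relations
  themselves.\<close>

lemma free_alg_simps [simp]:
  "mult (free_alg m) = (*)" "add (free_alg m) = (+)"
  "one (free_alg m) = 1" "zero (free_alg m) = 0"
  by (simp_all add: free_alg_def)

lemma free_gen_carrier: "i \<in> {1..<m} \<Longrightarrow> free_gen i \<in> carrier (free_alg m)"
  by (simp add: free_gen_def free_alg_def)

lemma K_const_carrier: "K_const a \<in> carrier (free_alg m)"
  by (simp add: K_const_def free_alg_def zero_word_def)

lemma add_carrier:
  "x \<in> carrier (free_alg m) \<Longrightarrow> y \<in> carrier (free_alg m) \<Longrightarrow> x + y \<in> carrier (free_alg m)"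
  using ring.ring_simprules(1)[OF ring_free_alg, of x m y] by simp

lemma mult_carrier:
  "x \<in> carrier (free_alg m) \<Longrightarrow> y \<in> carrier (free_alg m) \<Longrightarrow> x * y \<in> carrier (free_alg m)"
  using ring.ring_simprules(5)[OF ring_free_alg, of x m y] by simp

lemma uminus_carrier: "x \<in> carrier (free_alg m) \<Longrightarrow> - x \<in> carrier (free_alg m)"
  by (simp add: free_alg_def)

lemma diff_carrier:
  "x \<in> carrier (free_alg m) \<Longrightarrow> y \<in> carrier (free_alg m) \<Longrightarrow> x - y \<in> carrier (free_alg m)"
  using add_carrier[OF _ uminus_carrier] by fastforce

lemma one_carrier: "1 \<in> carrier (free_alg m)"
  using ring.ring_simprules(6)[OF ring_free_alg, of m] by simp

lemma zero_carrier: "0 \<in> carrier (free_alg m)"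
  by (simp add: free_alg_def)

lemmas free_carrier = free_gen_carrier K_const_carrier add_carrier mult_carrier diff_carrier
  uminus_carrier one_carrier zero_carrier

lemma free_alg_a_inv: "x \<in> carrier (free_alg m) \<Longrightarrow> \<ominus>\<^bsub>free_alg m\<^esub> x = - x"
  by (rule abelian_group.minus_equality[OF ring.is_abelian_group[OF ring_free_alg]])
     (simp_all add: uminus_carrier)

lemma K_const_add: "K_const (a + b) = K_const a + K_const b"
  by (simp add: K_const_def single_add)

lemma K_const_mult: "K_const (a * b) = K_const a * K_const b"
  by (simp add: K_const_def mult_single)

lemma K_const_diff: "K_const (a - b) = K_const a - K_const b"
  by (simp add: K_const_def single_diff)

lemma K_const_uminus: "K_const (- a) = - K_const a"
  by (simp add: K_const_def single_uminus)

lemma K_const_0: "K_const 0 = 0"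
  by (simp add: K_const_def)

lemma K_const_1: "K_const 1 = 1"
  by (simp add: K_const_def)

text \<open>Setting a fresh key amounts to adding a single term, and zero is a single term with
  coefficient 0. Additive statements thus reduce to monomials.\<close>

lemma poly_mapping_induct_single [case_names single add]:
  assumes "\<And>u c. P (Poly_Mapping.single u c)" and "\<And>x y. P x \<Longrightarrow> P y \<Longrightarrow> P (x + y)"
  shows "P x"
proof (induction x rule: update_induct)
  case const
  show ?case using assms(1)[of undefined 0] by simp
next
  case (update f a b)
  have "Poly_Mapping.update a b f = f + Poly_Mapping.single a b"
    using update by (intro poly_mapping_eqI)
      (auto simp: lookup_update lookup_add lookup_single when_def in_keys_iff)
  then show ?case using assms update by simp
qed

text \<open>Constants sit at the empty word, which is neutral for concatenation, and the
  coefficients commute; monomials suffice.\<close>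

lemma K_const_commute: "x * K_const c = K_const c * x"
  by (induction x rule: poly_mapping_induct_single)
     (simp_all add: K_const_def mult_single mult.commute algebra_simps)

lemmas K_const_simps = K_const_add K_const_mult K_const_diff K_const_uminus K_const_0 K_const_1

section \<open>Passage from the free algebra to its quotient\<close>

interpretation hecke: ring "hecke m" for m
  by (rule ring_hecke)

lemma hecke_of_hom: "hecke_of m \<in> ring_hom (free_alg m) (hecke m)"
  using ideal.rcos_ring_hom[OF ideal_hecke_ideal, of m]
  by (simp add: hecke_of_def[abs_def] hecke_def)

lemma hecke_of_closed [simp]: "x \<in> carrier (free_alg m) \<Longrightarrow> hecke_of m x \<in> carrier (hecke m)"
  by (rule ring_hom_closed[OF hecke_of_hom])

lemma hecke_of_add:
  "x \<in> carrier (free_alg m) \<Longrightarrow> y \<in> carrier (free_alg m) \<Longrightarrow>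
   hecke_of m x \<oplus>\<^bsub>hecke m\<^esub> hecke_of m y = hecke_of m (x + y)"
  using ring_hom_add[OF hecke_of_hom] by simp

lemma hecke_of_mult:
  "x \<in> carrier (free_alg m) \<Longrightarrow> y \<in> carrier (free_alg m) \<Longrightarrow>
   hecke_of m x \<otimes>\<^bsub>hecke m\<^esub> hecke_of m y = hecke_of m (x * y)"
  using ring_hom_mult[OF hecke_of_hom] by simp

lemma hecke_of_one: "\<one>\<^bsub>hecke m\<^esub> = hecke_of m 1"
  using ring_hom_one[OF hecke_of_hom, of m] by simp

lemma hecke_of_eq_iff:
  assumes "x \<in> carrier (free_alg m)" "y \<in> carrier (free_alg m)"
  shows "hecke_of m x = hecke_of m y \<longleftrightarrow> x - y \<in> hecke_ideal m"
  using ring.quotient_eq_iff_same_a_r_cos[OF ring_free_alg ideal_hecke_ideal assms]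
  by (simp add: hecke_of_def a_minus_def free_alg_a_inv assms)

lemma hscale_hecke_of:
  "x \<in> carrier (free_alg m) \<Longrightarrow> hscale m c (hecke_of m x) = hecke_of m (K_const c * x)"
  by (simp add: hscale_def hecke_of_mult K_const_carrier)

text \<open>The trace of the larger ideal on the smaller free algebra is an ideal there and contains
  the smaller set of relators; \<open>hecke_ideal m\<close> is the least such ideal.\<close>

lemma hecke_ideal_mono: "hecke_ideal m \<subseteq> hecke_ideal (m + 1)"
proof -
  interpret I: ideal "hecke_ideal (m + 1)" "free_alg (m + 1)" by (rule ideal_hecke_ideal)
  have sub: "carrier (free_alg m) \<subseteq> carrier (free_alg (m + 1))"
    by (fastforce simp: free_alg_def)
  have "ideal (hecke_ideal (m + 1) \<inter> carrier (free_alg m)) (free_alg m)"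
  proof (rule idealI[OF ring_free_alg])
    show "subgroup (hecke_ideal (m + 1) \<inter> carrier (free_alg m)) (add_monoid (free_alg m))"
    proof (rule group.subgroupI[OF abelian_group.a_group[OF ring.is_abelian_group[OF ring_free_alg]]])
      show "hecke_ideal (m + 1) \<inter> carrier (free_alg m) \<noteq> {}"
        using additive_subgroup.zero_closed[OF I.is_additive_subgroup] zero_carrier[of m] by auto
      fix a b assume a: "a \<in> hecke_ideal (m + 1) \<inter> carrier (free_alg m)"
      then have "\<ominus>\<^bsub>free_alg (m+1)\<^esub> a = - a" "\<ominus>\<^bsub>free_alg m\<^esub> a = - a"
        using sub by (auto intro!: free_alg_a_inv)
      then show "inv\<^bsub>add_monoid (free_alg m)\<^esub> a \<in> hecke_ideal (m + 1) \<inter> carrier (free_alg m)"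
        using a additive_subgroup.a_inv_closed[OF I.is_additive_subgroup, of a] uminus_carrier[of a m] by (simp add: a_inv_def)
      assume "b \<in> hecke_ideal (m + 1) \<inter> carrier (free_alg m)"
      then show "a \<otimes>\<^bsub>add_monoid (free_alg m)\<^esub> b \<in> hecke_ideal (m + 1) \<inter> carrier (free_alg m)"
        using a additive_subgroup.a_closed[OF I.is_additive_subgroup, of a b] add_carrier[of a m b] by simp
    qed auto
  next
    fix a x assume "a \<in> hecke_ideal (m + 1) \<inter> carrier (free_alg m)" "x \<in> carrier (free_alg m)"
    then show "x \<otimes>\<^bsub>free_alg m\<^esub> a \<in> hecke_ideal (m + 1) \<inter> carrier (free_alg m)"
      "a \<otimes>\<^bsub>free_alg m\<^esub> x \<in> hecke_ideal (m + 1) \<inter> carrier (free_alg m)"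
      using I.I_l_closed[of a x] I.I_r_closed[of a x] sub mult_carrier[of a m x] mult_carrier[of x m a]
      by auto
  qed
  moreover have "hecke_relators m \<subseteq> hecke_ideal (m + 1) \<inter> carrier (free_alg m)"
  proof -
    have "hecke_relators m \<subseteq> hecke_relators (m + 1)"
      unfolding hecke_relators_def by (intro Un_mono) fastforce+
    also have "\<dots> \<subseteq> hecke_ideal (m + 1)"
      unfolding hecke_ideal_def by (rule ring.genideal_self[OF ring_free_alg hecke_relators_carrier])
    finally show ?thesis using hecke_relators_carrier by blast
  qed
  ultimately show ?thesis
    unfolding hecke_ideal_def[of m] using ring.genideal_minimal[OF ring_free_alg] by blast
qed

text \<open>The larger ideal absorbs the smaller one, so the sum of the larger ideal with a coset of
  the smaller is a single coset.\<close>

lemma hecke_incl_hecke_of: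
  assumes "x \<in> carrier (free_alg m)"
  shows "hecke_incl m (hecke_of m x) = hecke_of (m + 1) x"
proof -
  interpret I: ideal "hecke_ideal m" "free_alg m" by (rule ideal_hecke_ideal)
  interpret J: ideal "hecke_ideal (m + 1)" "free_alg (m + 1)" by (rule ideal_hecke_ideal)
  have *: "h + h' \<in> hecke_ideal (m + 1)"
    if "h \<in> hecke_ideal (m + 1)" "h' \<in> hecke_ideal m" for h h'
    using additive_subgroup.a_closed[OF J.is_additive_subgroup that(1), of h'] that hecke_ideal_mono[of m]
    unfolding free_alg_simps by blast
  have 0: "0 \<in> hecke_ideal m"
    using additive_subgroup.zero_closed[OF I.is_additive_subgroup] unfolding free_alg_simps .
  have "{h + (h' + x) | h h'. h \<in> hecke_ideal (m + 1) \<and> h' \<in> hecke_ideal m}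
      = {h + x | h. h \<in> hecke_ideal (m + 1)}" (is "?A = ?B")
  proof (intro equalityI subsetI)
    fix y assume "y \<in> ?A"
    then obtain h h' where "h \<in> hecke_ideal (m + 1)" "h' \<in> hecke_ideal m" "y = h + (h' + x)"
      by blast
    then have "y = (h + h') + x" "h + h' \<in> hecke_ideal (m + 1)"
      using * by (simp_all only: add.assoc)
    then show "y \<in> ?B" by blast
  next
    fix y assume "y \<in> ?B"
    then obtain h where h: "h \<in> hecke_ideal (m + 1)" "y = h + x"
      by blast
    have "y = h + (0 + x)" using h by simp
    then show "y \<in> ?A" using h(1) 0 by blast
  qed
  moreover have "hecke_incl m (hecke_of m x) = ?A" and "hecke_of (m + 1) x = ?B"
    unfolding hecke_incl_def hecke_of_def a_r_coset_def' set_add_def' free_alg_simps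
    by (simp_all only: UN_iff set_eq_iff mem_Collect_eq singleton_iff) blast+
  ultimately show ?thesis by (simp only:)
qed

section \<open>The left regular representation of $H_3$\<close>

primrec H3_free :: "H3_basis \<Rightarrow> free_elt" where
  "H3_free B0 = 1"
| "H3_free B1 = free_gen 1"
| "H3_free B2 = free_gen 2"
| "H3_free B12 = free_gen 1 * free_gen 2"
| "H3_free B21 = free_gen 2 * free_gen 1"
| "H3_free B121 = free_gen 1 * free_gen 2 * free_gen 1"

definition H3_free_comb :: "(H3_basis \<Rightarrow> qz_field) \<Rightarrow> free_elt" where
  "H3_free_comb c = K_const (c B0) * H3_free B0 + K_const (c B1) * H3_free B1
     + K_const (c B2) * H3_free B2 + K_const (c B12) * H3_free B12
     + K_const (c B21) * H3_free B21 + K_const (c B121) * H3_free B121"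

lemma free_gen_carrier_3:
  "free_gen 1 \<in> carrier (free_alg 3)" "free_gen 2 \<in> carrier (free_alg 3)"
  by (simp_all add: free_gen_carrier)

lemma H3_free_carrier: "H3_free b \<in> carrier (free_alg 3)"
  by (cases b) (auto intro!: free_carrier)

lemma H3_free_comb_carrier: "H3_free_comb c \<in> carrier (free_alg 3)"
  unfolding H3_free_comb_def by (intro free_carrier H3_free_carrier)

lemma H3_elt_eq: "H3_elt b = hecke_of 3 (H3_free b)"
  by (cases b) (simp_all add: hT_def hecke_of_one hecke_of_mult free_gen_carrier mult_carrier)

lemma H3_comb_eq: "H3_comb c = hecke_of 3 (H3_free_comb c)"
  unfolding H3_comb_def H3_free_comb_def H3_elt_eq
  by (simp only: hscale_hecke_of H3_free_carrier hecke_of_add free_carrier)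

text \<open>Left multiplication by T_1 in coordinates. It preserves the planes spanned by {1, T_1},
  {T_2, T_1 T_2} and {T_2 T_1, T_1 T_2 T_1}, and acts on each by the same 2x2 matrix.\<close>

primrec mulT1 :: "(H3_basis \<Rightarrow> qz_field) \<Rightarrow> H3_basis \<Rightarrow> qz_field" where
  "mulT1 c B0 = K_q * c B1"
| "mulT1 c B1 = c B0 + (K_q - 1) * c B1"
| "mulT1 c B2 = K_q * c B12"
| "mulT1 c B12 = c B2 + (K_q - 1) * c B12"
| "mulT1 c B21 = K_q * c B121"
| "mulT1 c B121 = c B21 + (K_q - 1) * c B121"

text \<open>The analogue for T_2, with planes {1, T_2}, {T_1, T_2 T_1} and {T_1 T_2, T_1 T_2 T_1}.
  The last pairing rests on the braid relation T_2 T_1 T_2 = T_1 T_2 T_1.\<close>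

primrec mulT2 :: "(H3_basis \<Rightarrow> qz_field) \<Rightarrow> H3_basis \<Rightarrow> qz_field" where
  "mulT2 c B0 = K_q * c B2"
| "mulT2 c B1 = K_q * c B21"
| "mulT2 c B2 = c B0 + (K_q - 1) * c B2"
| "mulT2 c B12 = K_q * c B121"
| "mulT2 c B21 = c B1 + (K_q - 1) * c B21"
| "mulT2 c B121 = c B12 + (K_q - 1) * c B121"

section \<open>Normal forms modulo explicit combinations of relators\<close>

lemma hecke_ideal_quadratic:
  "i \<in> {1..<m} \<Longrightarrow>
   free_gen i * free_gen i - (K_const (K_q - 1) * free_gen i + K_const K_q) \<in> hecke_ideal m"
  using ring.genideal_self[OF ring_free_alg hecke_relators_carrier, of m]
  unfolding hecke_ideal_def hecke_relators_def by blast

lemma hecke_ideal_braid: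
  "i \<in> {1..<m} \<Longrightarrow> i + 1 \<in> {1..<m} \<Longrightarrow>
   free_gen i * free_gen (i + 1) * free_gen i - free_gen (i + 1) * free_gen i * free_gen (i + 1)
     \<in> hecke_ideal m"
  using ring.genideal_self[OF ring_free_alg hecke_relators_carrier, of m]
  unfolding hecke_ideal_def hecke_relators_def by blast

lemma hecke_ideal_add: "x \<in> hecke_ideal m \<Longrightarrow> y \<in> hecke_ideal m \<Longrightarrow> x + y \<in> hecke_ideal m"
  using additive_subgroup.a_closed[OF ideal.axioms(1)[OF ideal_hecke_ideal], of x m y] by simp

lemma hecke_ideal_mult_left:
  "x \<in> hecke_ideal m \<Longrightarrow> y \<in> carrier (free_alg m) \<Longrightarrow> y * x \<in> hecke_ideal m"
  using ideal.I_l_closed[OF ideal_hecke_ideal, of x m y] by simp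

lemma hecke_ideal_mult_right:
  "x \<in> hecke_ideal m \<Longrightarrow> y \<in> carrier (free_alg m) \<Longrightarrow> x * y \<in> hecke_ideal m"
  using ideal.I_r_closed[OF ideal_hecke_ideal, of x m y] by simp

lemma hecke_ideal_diff: "x \<in> hecke_ideal m \<Longrightarrow> y \<in> hecke_ideal m \<Longrightarrow> x - y \<in> hecke_ideal m"
  using hecke_ideal_add[of x m "(- 1) * y"] hecke_ideal_mult_left[of y m "- 1"]
  by (simp add: uminus_carrier one_carrier)

lemma free_gen_K_const:
  "free_gen i * K_const c = K_const c * free_gen i"
  "free_gen i * (K_const c * y) = K_const c * (free_gen i * y)"
  by (rule K_const_commute) (metis K_const_commute mult.assoc)

text \<open>Commutation together with left-commutation lets ordered rewriting sort the scalars,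
  although the free algebra is not commutative.\<close>

lemma K_const_K_const:
  "K_const a * K_const b = K_const b * K_const a"
  "K_const a * (K_const b * y) = K_const b * (K_const a * y)"
  by (rule K_const_commute) (metis K_const_commute mult.assoc)

lemma mulT1_correct: "free_gen 1 * H3_free_comb c - H3_free_comb (mulT1 c) \<in> hecke_ideal 3"
proof -
  define R where "R = free_gen 1 * free_gen 1 - (K_const (K_q - 1) * free_gen 1 + K_const K_q)"
  have R: "R \<in> hecke_ideal 3"
    unfolding R_def by (rule hecke_ideal_quadratic) simp
  \<comment> \<open>Only the basis words that begin with T_1 produce a square; each leaves the
    quadratic relator times the rest of the word.\<close>
  have "free_gen 1 * H3_free_comb c - H3_free_comb (mulT1 c)
      = K_const (c B1) * R + K_const (c B12) * (R * free_gen 2)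
        + K_const (c B121) * (R * (free_gen 2 * free_gen 1))"
    unfolding R_def H3_free_comb_def
    by (simp add: K_const_simps algebra_simps free_gen_K_const K_const_K_const)
  also have "\<dots> \<in> hecke_ideal 3"
    by (intro hecke_ideal_add R hecke_ideal_mult_right[OF R] hecke_ideal_mult_left free_carrier) simp_all
  finally show ?thesis .
qed

lemma mulT2_correct: "free_gen 2 * H3_free_comb c - H3_free_comb (mulT2 c) \<in> hecke_ideal 3"
proof -
  define R1 where "R1 = free_gen 1 * free_gen 1 - (K_const (K_q - 1) * free_gen 1 + K_const K_q)"
  define R2 where "R2 = free_gen 2 * free_gen 2 - (K_const (K_q - 1) * free_gen 2 + K_const K_q)"
  define B where "B = free_gen 1 * free_gen 2 * free_gen 1 - free_gen 2 * free_gen 1 * free_gen 2"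
  have R: "R1 \<in> hecke_ideal 3" "R2 \<in> hecke_ideal 3"
    unfolding R1_def R2_def by (rule hecke_ideal_quadratic; simp)+
  have B: "B \<in> hecke_ideal 3"
    using hecke_ideal_braid[of 1 3] by (simp add: B_def numeral_2_eq_2)
  \<comment> \<open>T_2 and T_2 T_1 produce a square of T_2. The word T_2 T_1 T_2 costs one braid
    relator, and T_2 T_1 T_2 T_1 becomes T_1 T_2 T_1 T_1 by a braid relator before the square of T_1
    is reduced.\<close>
  have "free_gen 2 * H3_free_comb c - H3_free_comb (mulT2 c)
      = K_const (c B2) * R2 + K_const (c B21) * (R2 * free_gen 1) - K_const (c B12) * B
        + K_const (c B121) * (free_gen 1 * free_gen 2 * R1 - B * free_gen 1)"
    unfolding R1_def R2_def B_def H3_free_comb_def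
    by (simp add: K_const_simps algebra_simps free_gen_K_const K_const_K_const)
  also have "\<dots> \<in> hecke_ideal 3"
    by (intro hecke_ideal_add hecke_ideal_diff R B hecke_ideal_mult_right[OF R(2)]
        hecke_ideal_mult_right[OF B] hecke_ideal_mult_left free_carrier) simp_all
  finally show ?thesis .
qed

section \<open>The free algebra acting on K^6\<close>

primrec act :: "nat list \<Rightarrow> (H3_basis \<Rightarrow> qz_field) \<Rightarrow> H3_basis \<Rightarrow> qz_field" where
  "act [] c = c"
| "act (i # u) c = (if i = 1 then mulT1 (act u c) else mulT2 (act u c))"

text \<open>The linear extension of \<open>act\<close> from words to all of \<open>free_elt\<close>.
  Any letter other than 1 acts as T_2, which is harmless: in \<open>free_alg 3\<close> the only
  other letter is 2.\<close>

definition action :: "free_elt \<Rightarrow> (H3_basis \<Rightarrow> qz_field) \<Rightarrow> H3_basis \<Rightarrow> qz_field" where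
  "action x c b = (\<Sum>u\<in>Poly_Mapping.keys x. Poly_Mapping.lookup x u * act (letters u) c b)"

lemma act_append: "act (u @ v) c = act u (act v c)"
  by (induction u) auto

lemma mulT_linear:
  "mulT1 (\<lambda>b. x b + y b) = (\<lambda>b. mulT1 x b + mulT1 y b)"
  "mulT2 (\<lambda>b. x b + y b) = (\<lambda>b. mulT2 x b + mulT2 y b)"
  "mulT1 (\<lambda>b. k * x b) = (\<lambda>b. k * mulT1 x b)"
  "mulT2 (\<lambda>b. k * x b) = (\<lambda>b. k * mulT2 x b)"
  by (rule ext, rename_tac b, case_tac b; simp add: algebra_simps)+

lemma act_linear:
  "act u (\<lambda>b. x b + y b) = (\<lambda>b. act u x b + act u y b)"
  "act u (\<lambda>b. k * x b) = (\<lambda>b. k * act u x b)"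
  by (induction u) (simp_all add: mulT_linear)

lemma action_single: "action (Poly_Mapping.single u k) c b = k * act (letters u) c b"
  by (simp add: action_def)

lemma action_superset:
  assumes "finite A" "Poly_Mapping.keys x \<subseteq> A"
  shows "action x c b = (\<Sum>u\<in>A. Poly_Mapping.lookup x u * act (letters u) c b)"
  unfolding action_def using assms by (intro sum.mono_neutral_left) (auto simp: in_keys_iff)

lemma action_add: "action (x + y) c b = action x c b + action y c b"
proof -
  let ?A = "Poly_Mapping.keys x \<union> Poly_Mapping.keys y"
  have "finite ?A" by simp
  then show ?thesis
    using Poly_Mapping.keys_add[of x y]
    by (simp add: action_superset[of ?A] Poly_Mapping.lookup_add algebra_simps sum.distrib)
qed

lemma action_add_right: "action x (\<lambda>b. c b + d b) b = action x c b + action x d b"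
  by (simp add: action_def act_linear algebra_simps sum.distrib)

lemma action_uminus: "action (- x) c b = - action x c b"
  by (simp add: action_def sum_negf)

lemma action_diff: "action (x - y) c b = action x c b - action y c b"
  using action_add[of x "- y"] by (simp add: action_uminus)

text \<open>Both sides are additive in each factor, so two monomials suffice, where the claim is
  \<open>act_append\<close>.\<close>

lemma action_mult: "action (x * y) c = action x (action y c)"
proof (induction x rule: poly_mapping_induct_single)
  case (single u k)
  show ?case
  proof (induction y rule: poly_mapping_induct_single)
    case (single v l)
    have "action (Poly_Mapping.single v l) c = (\<lambda>b. l * act (letters v) c b)"
      by (simp add: action_single fun_eq_iff)
    then show ?case
      by (simp add: fun_eq_iff mult_single action_single plus_word_def act_append act_linear)
  next
    case (add y z)
    have "action (y + z) c = (\<lambda>b. action y c b + action z c b)"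
      by (simp add: action_add fun_eq_iff)
    with add show ?case
      by (simp add: fun_eq_iff distrib_left action_add action_add_right)
  qed
next
  case (add x y)
  then show ?case by (simp add: fun_eq_iff distrib_right action_add)
qed

lemma action_K_const: "action (K_const k) c b = k * c b"
  by (simp add: K_const_def action_single zero_word_def)

lemma action_one: "action 1 c b = c b"
  using action_K_const[of 1] by (simp add: K_const_1)

lemma action_free_gen: "action (free_gen 1) c = mulT1 c" "action (free_gen 2) c = mulT2 c"
  by (simp_all add: fun_eq_iff free_gen_def action_single)

lemma action_zero_right: "action x (\<lambda>b. 0) b = 0"
  using act_linear(2)[of _ 0 "\<lambda>b. 0"] by (simp add: action_def)

text \<open>Among the indices 1 and 2 no two are far apart, so far commutation contributes nothing,
  and the braid relation occurs for i = 1 alone.\<close>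

lemma hecke_relators_3:
  assumes "r \<in> hecke_relators 3"
  shows "\<exists>i\<in>{1,2}. r = free_gen i * free_gen i - (K_const (K_q - 1) * free_gen i + K_const K_q)
      \<or> r = free_gen 1 * free_gen 2 * free_gen 1 - free_gen 2 * free_gen 1 * free_gen 2"
  using assms unfolding hecke_relators_def
proof (elim UnE CollectE exE conjE)
  fix i assume "r = free_gen i * free_gen i - (K_const (K_q - 1) * free_gen i + K_const K_q)"
    "i \<in> {1..<3}"
  moreover from this have "i \<in> {1, 2}" by auto
  ultimately show ?thesis by blast
next
  fix i assume "r = free_gen i * free_gen (i + 1) * free_gen i
      - free_gen (i + 1) * free_gen i * free_gen (i + 1)"
    "i \<in> {1..<3}" "i + 1 \<in> {1..<3}"
  moreover from this have "i = 1" by simp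
  ultimately show ?thesis by (intro bexI[of _ 1] disjI2) (simp_all add: numeral_2_eq_2)
qed auto

text \<open>The annihilator of a module is a two-sided ideal, so it suffices that the relators act
  as zero, that is, that \<open>mulT1\<close> and \<open>mulT2\<close> satisfy the quadratic and
  braid relations coordinate by coordinate. The action therefore descends to H_3.\<close>

lemma action_hecke_ideal:
  assumes "x \<in> hecke_ideal 3"
  shows "action x c b = 0"
proof -
  \<comment> \<open>All vectors have to be annihilated, not one fixed vector: in a right multiple,
    the annihilating element is applied to a vector that has already been moved.\<close>
  let ?I = "{x \<in> carrier (free_alg 3). \<forall>c b. action x c b = 0}"
  have "ideal ?I (free_alg 3)"
  proof (rule idealI[OF ring_free_alg])
    show "subgroup ?I (add_monoid (free_alg 3))"
    proof (rule group.subgroupI[OF abelian_group.a_group[OF ring.is_abelian_group[OF ring_free_alg]]])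
      have "0 \<in> ?I" using zero_carrier by (simp add: action_def)
      then show "?I \<noteq> {}" by blast
      fix a b assume "a \<in> ?I"
      then show "inv\<^bsub>add_monoid (free_alg 3)\<^esub> a \<in> ?I"
        using free_alg_a_inv[of a 3] by (simp add: a_inv_def action_uminus uminus_carrier)
      assume "b \<in> ?I"
      with \<open>a \<in> ?I\<close> show "a \<otimes>\<^bsub>add_monoid (free_alg 3)\<^esub> b \<in> ?I"
        by (simp add: action_add add_carrier)
    qed auto
  next
    fix a x assume a: "a \<in> ?I" "x \<in> carrier (free_alg 3)"
    then have "action a = (\<lambda>c b. 0)" by (simp add: fun_eq_iff)
    with a show "x \<otimes>\<^bsub>free_alg 3\<^esub> a \<in> ?I" "a \<otimes>\<^bsub>free_alg 3\<^esub> x \<in> ?I"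
      by (simp_all add: action_mult mult_carrier action_zero_right)
  qed
  moreover have "hecke_relators 3 \<subseteq> ?I"
  proof
    fix r assume r: "r \<in> hecke_relators 3"
    have "action r c b = 0" for c b
      using hecke_relators_3[OF r]
      by (elim bexE disjE; hypsubst; cases b;
          auto simp: action_diff action_add action_mult action_K_const action_free_gen
            algebra_simps simp del: One_nat_def)
    then show "r \<in> ?I" using r hecke_relators_carrier by blast
  qed
  ultimately have "hecke_ideal 3 \<subseteq> ?I"
    unfolding hecke_ideal_def by (intro ring.genideal_minimal[OF ring_free_alg])
  with assms show ?thesis by blast
qed

text \<open>Acting on the coordinate vector of the unit recovers the coefficients.\<close>

lemma H3_comb_inj:
  assumes "H3_comb c = H3_comb d"
  shows "c = d"
proof
  fix b
  define e where "e = (\<lambda>b. if b = B0 then 1 else 0 :: qz_field)"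
  have *: "action (H3_free_comb c) e b = c b" for c
    unfolding H3_free_comb_def
    by (cases b) (simp_all add: action_add action_mult action_K_const action_free_gen action_one e_def
        del: One_nat_def)
  have "H3_free_comb c - H3_free_comb d \<in> hecke_ideal 3"
    using assms by (simp add: H3_comb_eq hecke_of_eq_iff H3_free_comb_carrier)
  from action_hecke_ideal[OF this, of e b] show "c b = d b"
    by (simp add: action_diff *)
qed

section \<open>The coefficients of $(T_1T_2^{-1})^n$\<close>

lemma K_q_nonzero: "K_q \<noteq> 0" and K_z_nonzero: "K_z \<noteq> 0"
  by (simp_all add: K_q_def K_z_def Zero_fract_def eq_fract)

definition free_inv :: "nat \<Rightarrow> free_elt" where
  "free_inv i = K_const (1 / K_q) * (free_gen i - K_const (K_q - 1))"

lemma free_inv_carrier: "i \<in> {1..<m} \<Longrightarrow> free_inv i \<in> carrier (free_alg m)"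
  unfolding free_inv_def by (intro free_carrier)

lemma hT_closed: "i \<in> {1..<m} \<Longrightarrow> hT m i \<in> carrier (hecke m)"
  by (simp add: hT_def free_gen_carrier)

text \<open>Since \<open>free_inv i\<close> is a polynomial in T_i, it commutes with T_i in the free
  algebra, and both products exceed 1 by the same multiple of the quadratic relator.\<close>

lemma free_inv_correct:
  assumes i: "i \<in> {1..<m}"
  shows "hT m i \<otimes>\<^bsub>hecke m\<^esub> hecke_of m (free_inv i) = \<one>\<^bsub>hecke m\<^esub>"
    and "hecke_of m (free_inv i) \<otimes>\<^bsub>hecke m\<^esub> hT m i = \<one>\<^bsub>hecke m\<^esub>"
proof -
  define R where "R = free_gen i * free_gen i - (K_const (K_q - 1) * free_gen i + K_const K_q)"
  have R: "K_const (1 / K_q) * R \<in> hecke_ideal m"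
    unfolding R_def by (intro hecke_ideal_mult_left hecke_ideal_quadratic[OF i] K_const_carrier)
  have one: "K_const (1 / K_q) * K_const K_q = 1"
    using K_q_nonzero by (simp add: K_const_mult[symmetric] K_const_1)
  have "free_gen i * free_inv i = 1 + K_const (1 / K_q) * R"
    "free_inv i * free_gen i = 1 + K_const (1 / K_q) * R"
    unfolding R_def free_inv_def right_diff_distrib distrib_left one
    by (simp_all add: algebra_simps free_gen_K_const)
  with R have "free_gen i * free_inv i - 1 \<in> hecke_ideal m" "free_inv i * free_gen i - 1 \<in> hecke_ideal m"
    by simp_all
  then show "hT m i \<otimes>\<^bsub>hecke m\<^esub> hecke_of m (free_inv i) = \<one>\<^bsub>hecke m\<^esub>"
    "hecke_of m (free_inv i) \<otimes>\<^bsub>hecke m\<^esub> hT m i = \<one>\<^bsub>hecke m\<^esub>"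
    unfolding hT_def hecke_of_one
    by (simp_all only: hecke_of_mult hecke_of_eq_iff free_carrier free_inv_carrier i)
qed

lemma hT_Units: "i \<in> {1..<m} \<Longrightarrow> hT m i \<in> Units (hecke m)"
  unfolding Units_def using free_inv_correct hT_closed free_inv_carrier hecke_of_closed by blast

lemma hscale_H3_comb: "hscale 3 k (H3_comb c) = H3_comb (\<lambda>b. k * c b)"
proof -
  have "K_const k * H3_free_comb c = H3_free_comb (\<lambda>b. k * c b)"
    by (simp add: H3_free_comb_def K_const_simps algebra_simps)
  then show ?thesis by (simp add: H3_comb_eq hscale_hecke_of H3_free_comb_carrier)
qed

lemma H3_comb_closed: "H3_comb c \<in> carrier (hecke 3)"
  by (simp add: H3_comb_eq H3_free_comb_carrier)

lemma hT_H3_comb: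
  "hT 3 1 \<otimes>\<^bsub>hecke 3\<^esub> H3_comb c = H3_comb (mulT1 c)"
  "hT 3 2 \<otimes>\<^bsub>hecke 3\<^esub> H3_comb c = H3_comb (mulT2 c)"
  unfolding hT_def H3_comb_eq
  using mulT1_correct[of c] mulT2_correct[of c]
  by (simp_all only: hecke_of_mult hecke_of_eq_iff free_gen_carrier_3 H3_free_comb_carrier free_carrier)

text \<open>The coordinates are those of q^{-1} (T_2 - (q-1)). To verify them, T_2 is applied, which
  gives \<open>c\<close> back, and then T_2 is cancelled as a unit.\<close>

lemma inv_hT_H3_comb:
  "inv\<^bsub>hecke 3\<^esub> hT 3 2 \<otimes>\<^bsub>hecke 3\<^esub> H3_comb c = H3_comb (\<lambda>b. (mulT2 c b - (K_q - 1) * c b) / K_q)"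
proof -
  define c' where "c' = (\<lambda>b. (mulT2 c b - (K_q - 1) * c b) / K_q)"
  have "mulT2 c' = c"
  proof
    fix b show "mulT2 c' b = c b"
      using K_q_nonzero by (cases b) (simp_all add: c'_def field_simps)
  qed
  then have "hT 3 2 \<otimes>\<^bsub>hecke 3\<^esub> H3_comb c' = H3_comb c"
    by (simp add: hT_H3_comb)
  then show ?thesis
    unfolding c'_def[symmetric]
    using hT_Units[of 2 3] H3_comb_closed[of c'] hecke.Units_closed hecke.Units_inv_closed
    by (simp add: hecke.m_assoc[symmetric] flip: \<open>hT 3 2 \<otimes>\<^bsub>hecke 3\<^esub> H3_comb c' = H3_comb c\<close>)
qed

lemma H3_comb_unit: "\<one>\<^bsub>hecke 3\<^esub> = H3_comb (\<lambda>b. if b = B0 then 1 else 0)"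
  by (simp add: hecke_of_one H3_comb_eq H3_free_comb_def K_const_simps)

section \<open>Evaluation of polynomials with transported coefficients\<close>

lemma poly_map_poly_pCons:
  "h 0 = 0 \<Longrightarrow> poly (map_poly h (pCons a p)) x = h a + x * poly (map_poly h p) x"
  by (simp add: map_poly_pCons)

lemma poly_map_poly_add:
  assumes "h 0 = 0" and "\<And>a b. h (a + b) = h a + h b"
  shows "poly (map_poly h (p + r)) x = poly (map_poly h p) x + poly (map_poly h r) x"
proof -
  have "map_poly h (p + r) = map_poly h p + map_poly h r"
    by (rule poly_eqI) (simp add: coeff_map_poly assms)
  then show ?thesis by simp
qed

text \<open>The coefficient map is kept abstract because this serves three times: for integer
  coefficients, and for the inner and the outer level of the substitution in q and z.\<close>

lemma poly_map_poly_mult: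
  assumes h: "h 0 = 0" "\<And>a b. h (a + b) = h a + h b" "\<And>a b. h (a * b) = h a * h b"
  shows "poly (map_poly h (p * r)) x = poly (map_poly h p) x * poly (map_poly h r) x"
proof -
  have smult: "poly (map_poly h (smult a r)) x = h a * poly (map_poly h r) x" for a
    by (induction r) (simp_all add: poly_map_poly_pCons h algebra_simps)
  show ?thesis
    by (induction p) (simp_all add: poly_map_poly_pCons poly_map_poly_add smult h algebra_simps)
qed

lemma int_poly_at_pCons: "int_poly_at (pCons a p) x = of_int a + x * int_poly_at p x"
  by (simp add: int_poly_at_def poly_map_poly_pCons)

lemma int_poly_at_0 [simp]: "int_poly_at 0 x = 0"
  by (simp add: int_poly_at_def)

lemma int_poly_at_1 [simp]: "int_poly_at 1 x = 1"
  by (simp add: int_poly_at_def)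

lemma int_poly_at_add [simp]: "int_poly_at (p + r) x = int_poly_at p x + int_poly_at r x"
  by (simp add: int_poly_at_def poly_map_poly_add)

lemma int_poly_at_minus [simp]: "int_poly_at (- p) x = - int_poly_at p x"
  using int_poly_at_add[of p "- p" x] by (simp add: eq_neg_iff_add_eq_0 add.commute)

lemma int_poly_at_diff [simp]: "int_poly_at (p - r) x = int_poly_at p x - int_poly_at r x"
  using int_poly_at_add[of p "- r" x] by simp

lemma int_poly_at_mult [simp]: "int_poly_at (p * r) x = int_poly_at p x * int_poly_at r x"
  by (simp add: int_poly_at_def poly_map_poly_mult)

lemma int_poly_at_power [simp]: "int_poly_at (p ^ k) x = int_poly_at p x ^ k"
  by (induction k) simp_all

lemma int_poly_at_var [simp]: "int_poly_at [:0, 1:] x = x"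
  by (simp add: int_poly_at_pCons)

lemma int_poly_at_numeral [simp]: "int_poly_at (numeral k) x = numeral k"
  by (simp add: numeral_poly int_poly_at_pCons)

lemma of_int_fract: "(of_int a :: 'a::idom fract) = Fraction_Field.Fract (of_int a) 1"
  by (cases a) (simp_all add: of_nat_fract One_fract_def)

lemma int_poly_at_K_q: "int_poly_at p K_q = Fraction_Field.Fract [:map_poly of_int p:] 1"
proof (induction p)
  case 0
  show ?case by (simp add: Zero_fract_def)
next
  case (pCons a p)
  then show ?case
    by (simp add: int_poly_at_pCons map_poly_pCons of_int_fract K_q_def of_int_poly)
qed

text \<open>The element q is transcendental: the value at q is the polynomial itself as a fraction
  with denominator 1, and the integers embed into the complex numbers.\<close>

lemma int_poly_at_K_q_inj: "int_poly_at p K_q = int_poly_at r K_q \<Longrightarrow> p = r"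
  by (simp add: int_poly_at_K_q eq_fract) (simp add: poly_eq_iff coeff_map_poly)

text \<open>The six coefficients are determined by three of them: the shape
  $C_{121} = 0$, $C_1 = -(q-1) C_{12}$, $C_2 = -(q-1) C_{21}$ is preserved by left
  multiplication with $q T_1 T_2^{-1}$.\<close>

primrec weaving_coeff :: "nat \<Rightarrow> H3_basis \<Rightarrow> int poly" where
  "weaving_coeff 0 = (\<lambda>b. if b = B0 then 1 else 0)"
| "weaving_coeff (Suc n) =
     (let q = [:0, 1:]; a = weaving_coeff n B0; b = weaving_coeff n B12; d = weaving_coeff n B21
      in case_H3_basis
        (q ^ 2 * d + q * (q - 1) ^ 2 * b)
        (- (q - 1) * (a - (q - 1) ^ 2 * b))
        (- (q - 1) * q * b)
        (a - (q - 1) ^ 2 * b)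
        (q * b)
        0)"

text \<open>Every successor step writes its coefficients in this form outright, and at 0 all of them
  vanish, so a case distinction replaces induction.\<close>

lemma weaving_coeff_shape:
  "weaving_coeff n B121 = 0"
  "weaving_coeff n B1 = - ([:0, 1:] - 1) * weaving_coeff n B12"
  "weaving_coeff n B2 = - ([:0, 1:] - 1) * weaving_coeff n B21"
  by (cases n; simp add: Let_def algebra_simps)+

lemma weaving_power:
  "(hT 3 1 \<otimes>\<^bsub>hecke 3\<^esub> inv\<^bsub>hecke 3\<^esub> hT 3 2) [^]\<^bsub>hecke 3\<^esub> n
     = hscale 3 (K_q powi (- int n)) (H3_comb (\<lambda>b. int_poly_at (weaving_coeff n b) K_q))"
proof (induction n)
  case 0
  show ?case by (simp add: hscale_H3_comb H3_comb_unit if_distribR if_distrib[of "\<lambda>p. int_poly_at p _"]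
      cong: if_cong)
next
  case (Suc n)
  let ?x = "hT 3 1 \<otimes>\<^bsub>hecke 3\<^esub> inv\<^bsub>hecke 3\<^esub> hT 3 2"
  define k where "k = K_q powi (- int n)"
  define c where "c = (\<lambda>b. k * int_poly_at (weaving_coeff n b) K_q)"
  have T: "hT 3 1 \<in> carrier (hecke 3)" "inv\<^bsub>hecke 3\<^esub> hT 3 2 \<in> carrier (hecke 3)"
    using hT_closed[of 1 3] hecke.Units_inv_closed[OF hT_Units[of 2 3]] by simp_all
  have "- int (Suc n) = - int n - 1" by simp
  then have k: "K_q powi (- int (Suc n)) = k / K_q"
    using K_q_nonzero by (simp only: k_def power_int_diff power_int_1_right simp_thms)
  \<comment> \<open>The new factor is split off on the left, because the coordinate formulas
    describe left multiplication.\<close>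
  have "?x [^]\<^bsub>hecke 3\<^esub> Suc n = ?x \<otimes>\<^bsub>hecke 3\<^esub> H3_comb c"
    using hecke.nat_pow_Suc2[of ?x 3 n] T unfolding Suc.IH by (simp add: hscale_H3_comb c_def k_def)
  also have "\<dots> = H3_comb (mulT1 (\<lambda>b. (mulT2 c b - (K_q - 1) * c b) / K_q))"
    using T H3_comb_closed[of c]
    by (simp add: hecke.m_assoc inv_hT_H3_comb hT_H3_comb del: One_nat_def)
  also have "mulT1 (\<lambda>b. (mulT2 c b - (K_q - 1) * c b) / K_q)
      = (\<lambda>b. (k / K_q) * int_poly_at (weaving_coeff (Suc n) b) K_q)"
  proof
    fix b
    \<comment> \<open>An opaque name for the variable keeps products with it from being rewritten
      into \<open>pCons\<close> form.\<close>
    define v :: "int poly" where "v = [:0, 1:]"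
    have v: "int_poly_at v K_q = K_q" by (simp add: v_def)
    note shape = weaving_coeff_shape[folded v_def]
      and step = weaving_coeff.simps(2)[folded v_def, unfolded Let_def]
    \<comment> \<open>With \<open>shape\<close>, only the coefficients at \<open>B0\<close>,
      \<open>B12\<close> and \<open>B21\<close> remain, and each coordinate is a field identity in
      them.\<close>
    show "mulT1 (\<lambda>b. (mulT2 c b - (K_q - 1) * c b) / K_q) b
        = (k / K_q) * int_poly_at (weaving_coeff (Suc n) b) K_q"
      unfolding step
      using K_q_nonzero by (cases b) (simp_all add: c_def shape v field_simps power2_eq_square)
  qed
  finally show ?case by (simp only: hscale_H3_comb k)
qed

text \<open>For uniqueness, independence of the basis compares coefficients, the nonzero power of q
  cancels, and transcendence of q leads back to integer polynomials.\<close>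

lemma weaving_C_eq: "weaving_C n = weaving_coeff n"
  unfolding weaving_C_def
proof (rule the_equality)
  fix C
  assume "(hT 3 1 \<otimes>\<^bsub>hecke 3\<^esub> inv\<^bsub>hecke 3\<^esub> hT 3 2) [^]\<^bsub>hecke 3\<^esub> n
    = hscale 3 (K_q powi (- int n)) (H3_comb (\<lambda>b. int_poly_at (C b) K_q))"
  then have "H3_comb (\<lambda>b. K_q powi (- int n) * int_poly_at (C b) K_q)
      = H3_comb (\<lambda>b. K_q powi (- int n) * int_poly_at (weaving_coeff n b) K_q)"
    by (simp only: weaving_power hscale_H3_comb)
  from H3_comb_inj[OF this] show "C = weaving_coeff n"
    using K_q_nonzero by (auto simp: fun_eq_iff intro: int_poly_at_K_q_inj)
qed (rule weaving_power)

section \<open>The braid group and its representation\<close>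

lemma braid_words_append [simp]: "u @ v \<in> braid_words m \<longleftrightarrow> u \<in> braid_words m \<and> v \<in> braid_words m"
  by (auto simp: braid_words_def)

lemma braid_words_Nil [simp]: "[] \<in> braid_words m"
  by (simp add: braid_words_def)

lemma braid_words_Cons:
  "a # u \<in> braid_words m \<longleftrightarrow> strand a \<in> {1..<m} \<and> u \<in> braid_words m"
  by (auto simp: braid_words_def)

lemma braid_step_words: "braid_step m u v \<Longrightarrow> u \<in> braid_words m \<longleftrightarrow> v \<in> braid_words m"
  by (induction rule: braid_step.induct) (auto simp: braid_words_Cons)

lemma braid_step_append_left: "braid_step m u v \<Longrightarrow> braid_step m (w @ u) (w @ v)"
  by (induction rule: braid_step.induct) (metis append.assoc braid_step.intros)+

lemma braid_step_append_right:
  assumes "braid_step m u v"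
  shows "braid_step m (u @ w) (v @ w)"
  using assms
proof (induction rule: braid_step.induct)
  case (cancel_right i x y)
  then show ?case using braid_step.cancel_right[of i m x "y @ w"] by simp
next
  case (cancel_left i x y)
  then show ?case using braid_step.cancel_left[of i m x "y @ w"] by simp
next
  case (far_commute i j x y)
  then show ?case using braid_step.far_commute[of i m j x "y @ w"] by simp
next
  case (braid_rel i x y)
  then show ?case using braid_step.braid_rel[of i m x "y @ w"] by simp
qed

lemma equivclp_map:
  assumes "equivclp r a b" and "\<And>x y. r x y \<Longrightarrow> r (f x) (f y)"
  shows "equivclp r (f a) (f b)"
  using assms(1)
proof induction
  case base
  show ?case by (rule reflpD[OF reflp_equivclp])
next
  case (step y z)
  then have "equivclp r (f y) (f z)"
    using assms(2) by (auto intro: r_into_equivclp converse_r_into_equivclp)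
  with step.IH show ?case
    by (rule transpD[OF transp_equivclp])
qed

lemma equiv_braid_eq: "equiv (braid_words m) (braid_eq m)"
proof (rule equivI)
  show "refl_on (braid_words m) (braid_eq m)"
    by (rule refl_onI) (auto simp: braid_eq_def)
  show "sym (braid_eq m)"
    by (rule symI) (auto simp: braid_eq_def intro: equivclp_sym)
  show "trans (braid_eq m)"
    by (rule transI) (auto simp: braid_eq_def intro: transpD[OF transp_equivclp])
qed (auto simp: braid_eq_def)

lemma braid_eq_append:
  assumes "(u, u') \<in> braid_eq m" "(v, v') \<in> braid_eq m"
  shows "(u @ v, u' @ v') \<in> braid_eq m"
proof -
  \<comment> \<open>One factor is changed at a time, through the intermediate word
    \<open>u' @ v\<close>.\<close>
  have "equivclp (braid_step m) (u @ v) (u' @ v)" "equivclp (braid_step m) (u' @ v) (u' @ v')"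
    using assms by (auto simp: braid_eq_def intro!: equivclp_map[where f = "\<lambda>u. u @ v"]
        equivclp_map[where f = "\<lambda>v. u' @ v"] braid_step_append_left braid_step_append_right)
  then show ?thesis
    using assms by (auto simp: braid_eq_def intro: transpD[OF transp_equivclp])
qed

definition braid_class :: "nat \<Rightarrow> braid_letter list \<Rightarrow> braid_letter list set" where
  "braid_class m u = braid_eq m `` {u}"

lemma braid_class_eq: "(u, v) \<in> braid_eq m \<Longrightarrow> braid_class m u = braid_class m v"
  unfolding braid_class_def by (rule equiv_class_eq[OF equiv_braid_eq])

lemma braid_class_step:
  assumes "braid_step m u v" "u \<in> braid_words m"
  shows "braid_class m u = braid_class m v"
  using assms braid_step_words[OF assms(1)]
  by (intro braid_class_eq) (auto simp: braid_eq_def)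

lemma braid_class_closed: "u \<in> braid_words m \<Longrightarrow> braid_class m u \<in> carrier (braid_group m)"
  by (simp add: braid_group_def braid_class_def quotientI)

lemma braid_class_mult:
  assumes "u \<in> braid_words m" "v \<in> braid_words m"
  shows "braid_class m u \<otimes>\<^bsub>braid_group m\<^esub> braid_class m v = braid_class m (u @ v)"
proof -
  have "congruent2 (braid_eq m) (braid_eq m) (\<lambda>a b. braid_eq m `` {a @ b})"
    by (rule congruent2I') (intro equiv_class_eq[OF equiv_braid_eq] braid_eq_append)
  from UN_equiv_class2[OF equiv_braid_eq equiv_braid_eq this assms] show ?thesis
    by (simp add: braid_group_def braid_class_def)
qed

lemma braid_class_one: "\<one>\<^bsub>braid_group m\<^esub> = braid_class m []"
  by (simp add: braid_group_def braid_class_def)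

lemma braid_groupE:
  assumes "\<alpha> \<in> carrier (braid_group m)"
  obtains u where "u \<in> braid_words m" "\<alpha> = braid_class m u"
  using assms by (auto simp: braid_group_def braid_class_def elim: quotientE)

lemma monoid_braid_group: "Group.monoid (braid_group m)"
proof (rule Group.monoidI)
  fix x y z assume "x \<in> carrier (braid_group m)" "y \<in> carrier (braid_group m)"
    "z \<in> carrier (braid_group m)"
  then show "x \<otimes>\<^bsub>braid_group m\<^esub> y \<otimes>\<^bsub>braid_group m\<^esub> z
    = x \<otimes>\<^bsub>braid_group m\<^esub> (y \<otimes>\<^bsub>braid_group m\<^esub> z)"
    by (elim braid_groupE) (simp add: braid_class_mult)
qed (auto elim!: braid_groupE simp: braid_class_mult braid_class_one braid_class_closed)

interpretation braid: Group.monoid "braid_group m" for m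
  by (rule monoid_braid_group)

lemma inv_braid_gen:
  assumes i: "i \<in> {1..<m}"
  shows "inv\<^bsub>braid_group m\<^esub> braid_gen m i = braid_class m [SigInv i]"
proof -
  have w: "[Sig i] \<in> braid_words m" "[SigInv i] \<in> braid_words m"
    using i by (simp_all add: braid_words_Cons)
  have "braid_class m [SigInv i, Sig i] = braid_class m []"
    "braid_class m [Sig i, SigInv i] = braid_class m []"
    using braid_step.cancel_left[OF i, of "[]" "[]"] braid_step.cancel_right[OF i, of "[]" "[]"] i
    by (auto intro!: braid_class_step simp: braid_words_Cons)
  then show ?thesis
    using w unfolding braid_gen_def braid_class_def[symmetric]
    by (intro braid.inv_unique'[symmetric]) (simp_all add: braid_class_closed braid_class_mult braid_class_one)
qed

definition weaving_word :: "nat \<Rightarrow> braid_letter list" where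
  "weaving_word n = concat (replicate n [Sig 1, SigInv 2])"

lemma weaving_word_closed: "weaving_word n \<in> braid_words 3"
  by (induction n) (simp_all add: weaving_word_def braid_words_Cons)

lemma weaving_braid_eq: "weaving_braid n = braid_class 3 (weaving_word n)"
proof (induction n)
  case 0
  show ?case by (simp add: weaving_braid_def weaving_word_def braid_class_one)
next
  case (Suc n)
  have w: "[Sig 1, SigInv 2] \<in> braid_words 3"
    by (simp add: braid_words_Cons)
  have x: "braid_gen 3 1 \<otimes>\<^bsub>braid_group 3\<^esub> inv\<^bsub>braid_group 3\<^esub> braid_gen 3 2
      = braid_class 3 [Sig 1, SigInv 2]"
    by (simp add: inv_braid_gen) (simp add: braid_gen_def braid_words_Cons braid_class_mult
        flip: braid_class_def)
  have "weaving_braid (Suc n) = braid_class 3 [Sig 1, SigInv 2] \<otimes>\<^bsub>braid_group 3\<^esub> weaving_braid n"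
    unfolding weaving_braid_def x by (rule braid.nat_pow_Suc2[OF braid_class_closed[OF w]])
  also have "\<dots> = braid_class 3 (weaving_word (Suc n))"
    unfolding Suc braid_class_mult[OF w weaving_word_closed] by (simp add: weaving_word_def)
  finally show ?case .
qed

section \<open>Invariance of the Hecke representation and the exponent sum\<close>

lemma letter_rep_closed: "strand a \<in> {1..<m} \<Longrightarrow> letter_rep m a \<in> carrier (hecke m)"
  by (cases a) (use hT_closed hecke.Units_inv_closed[OF hT_Units] in auto)

lemma word_rep_closed: "u \<in> braid_words m \<Longrightarrow> word_rep m u \<in> carrier (hecke m)"
  by (induction u) (auto simp: braid_words_Cons letter_rep_closed)

lemma word_rep_append:
  "u \<in> braid_words m \<Longrightarrow> v \<in> braid_words m \<Longrightarrow>
   word_rep m (u @ v) = word_rep m u \<otimes>\<^bsub>hecke m\<^esub> word_rep m v"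
  by (induction u) (auto simp: braid_words_Cons letter_rep_closed word_rep_closed hecke.m_assoc)

lemma hecke_ideal_commute:
  "i \<in> {1..<m} \<Longrightarrow> j \<in> {1..<m} \<Longrightarrow> i + 2 \<le> j \<Longrightarrow>
   free_gen i * free_gen j - free_gen j * free_gen i \<in> hecke_ideal m"
  using ring.genideal_self[OF ring_free_alg hecke_relators_carrier, of m]
  unfolding hecke_ideal_def hecke_relators_def by blast

lemma hT_commute:
  assumes "i \<in> {1..<m}" "j \<in> {1..<m}" "i + 2 \<le> j"
  shows "hT m i \<otimes>\<^bsub>hecke m\<^esub> hT m j = hT m j \<otimes>\<^bsub>hecke m\<^esub> hT m i"
  using hecke_ideal_commute[OF assms] assms unfolding hT_def
  by (simp only: hecke_of_mult hecke_of_eq_iff free_carrier)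

lemma hT_braid:
  assumes "i \<in> {1..<m}" "i + 1 \<in> {1..<m}"
  shows "hT m i \<otimes>\<^bsub>hecke m\<^esub> (hT m (i + 1) \<otimes>\<^bsub>hecke m\<^esub> hT m i)
    = hT m (i + 1) \<otimes>\<^bsub>hecke m\<^esub> (hT m i \<otimes>\<^bsub>hecke m\<^esub> hT m (i + 1))"
  using hecke_ideal_braid[OF assms] assms unfolding hT_def
  by (simp only: hecke_of_mult hecke_of_eq_iff free_carrier mult.assoc)

lemma word_rep_infix:
  assumes "word_rep m u = word_rep m v" "x @ u @ y \<in> braid_words m" "v \<in> braid_words m"
  shows "word_rep m (x @ u @ y) = word_rep m (x @ v @ y)"
  using assms by (simp add: word_rep_append)

text \<open>Cancellations hold because the generators are units; the other two moves are relators of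
  the Hecke algebra, transported into context by \<open>word_rep_infix\<close>.\<close>

lemma braid_step_word_rep:
  assumes "braid_step m u v" "u \<in> braid_words m"
  shows "word_rep m u = word_rep m v"
  using assms
proof (induction rule: braid_step.induct)
  case (cancel_right i x y)
  then show ?case
    using hT_Units[of i m]
    by (simp add: word_rep_append braid_words_Cons hT_closed word_rep_closed flip: hecke.m_assoc)
next
  case (cancel_left i x y)
  then show ?case
    using hT_Units[of i m]
    by (simp add: word_rep_append braid_words_Cons hT_closed word_rep_closed flip: hecke.m_assoc)
next
  case (far_commute i j x y)
  have "word_rep m [Sig i, Sig j] = word_rep m [Sig j, Sig i]"
    using far_commute hT_commute[of i m j] by (simp add: hT_closed)
  then show ?case
    using far_commute by (intro word_rep_infix) (simp_all add: braid_words_Cons)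
next
  case (braid_rel i x y)
  have "word_rep m [Sig i, Sig (i + 1), Sig i] = word_rep m [Sig (i + 1), Sig i, Sig (i + 1)]"
    using braid_rel hT_braid[of i m] by (simp add: hT_closed)
  then show ?case
    using braid_rel by (intro word_rep_infix) (simp_all add: braid_words_Cons)
qed

lemma braid_step_exponent:
  "braid_step m u v \<Longrightarrow> sum_list (map letter_exponent u) = sum_list (map letter_exponent v)"
  by (induction rule: braid_step.induct) simp_all

lemma braid_eq_word_rep:
  assumes "(u, v) \<in> braid_eq m"
  shows "word_rep m u = word_rep m v"
proof -
  from assms have "equivclp (braid_step m) u v" "u \<in> braid_words m"
    by (auto simp: braid_eq_def)
  \<comment> \<open>Validity of the word is carried along: \<open>braid_step_word_rep\<close> asks
    for it at the source of a step, and \<open>equivclp\<close> also runs steps backwards.\<close>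
  then have "v \<in> braid_words m \<and> word_rep m u = word_rep m v"
    by induction (use braid_step_words braid_step_word_rep in metis)+
  then show ?thesis ..
qed

lemma braid_eq_exponent:
  assumes "(u, v) \<in> braid_eq m"
  shows "sum_list (map letter_exponent u) = sum_list (map letter_exponent v)"
proof -
  from assms have "equivclp (braid_step m) u v"
    by (auto simp: braid_eq_def)
  then show ?thesis
    by induction (auto dest: braid_step_exponent)
qed

text \<open>The image of the class is a singleton: the function is constant on it, and the class
  contains \<open>u\<close>.\<close>

lemma the_elem_braid_class:
  assumes "u \<in> braid_words m" and "\<And>v. (u, v) \<in> braid_eq m \<Longrightarrow> f u = f v"
  shows "the_elem (f ` braid_class m u) = f u"
proof -
  have "f ` braid_class m u = {f u}"
    using assms(2)[symmetric] equiv_class_self[OF equiv_braid_eq assms(1)]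
    unfolding braid_class_def by blast
  then show ?thesis by simp
qed

lemma braid_rep_class: "u \<in> braid_words m \<Longrightarrow> braid_rep m (braid_class m u) = word_rep m u"
  unfolding braid_rep_def by (rule the_elem_braid_class) (auto dest: braid_eq_word_rep)

lemma exponent_sum_class:
  "u \<in> braid_words m \<Longrightarrow> exponent_sum (braid_class m u) = sum_list (map letter_exponent u)"
  unfolding exponent_sum_def by (rule the_elem_braid_class) (auto dest: braid_eq_exponent)

lemma exponent_sum_weaving_braid: "exponent_sum (weaving_braid n) = 0"
proof -
  have "sum_list (map letter_exponent (weaving_word n)) = 0"
    by (induction n) (simp_all add: weaving_word_def)
  then show ?thesis
    by (simp add: weaving_braid_eq exponent_sum_class weaving_word_closed)
qed

lemma braid_rep_weaving_braid:
  "braid_rep 3 (weaving_braid n) =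
     (hT 3 1 \<otimes>\<^bsub>hecke 3\<^esub> inv\<^bsub>hecke 3\<^esub> hT 3 2) [^]\<^bsub>hecke 3\<^esub> n"
proof -
  have T: "hT 3 1 \<in> carrier (hecke 3)" "inv\<^bsub>hecke 3\<^esub> hT 3 2 \<in> carrier (hecke 3)"
    using hT_closed[of 1 3] hecke.Units_inv_closed[OF hT_Units[of 2 3]] by simp_all
  let ?x = "hT 3 1 \<otimes>\<^bsub>hecke 3\<^esub> inv\<^bsub>hecke 3\<^esub> hT 3 2"
  have "word_rep 3 (weaving_word n) = ?x [^]\<^bsub>hecke 3\<^esub> n"
  proof (induction n)
    case 0
    show ?case by (simp add: weaving_word_def)
  next
    case (Suc n)
    have "word_rep 3 (weaving_word (Suc n))
        = hT 3 1 \<otimes>\<^bsub>hecke 3\<^esub> (inv\<^bsub>hecke 3\<^esub> hT 3 2 \<otimes>\<^bsub>hecke 3\<^esub> word_rep 3 (weaving_word n))"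
      by (simp add: weaving_word_def)
    then show ?case
      unfolding Suc using T hecke.nat_pow_Suc2[of ?x 3 n] by (simp add: hecke.m_assoc)
  qed
  then show ?thesis
    by (simp add: weaving_braid_eq braid_rep_class weaving_word_closed)
qed

section \<open>Values of the trace\<close>

context
  fixes Tr :: "nat \<Rightarrow> free_elt set \<Rightarrow> qz_field"
  assumes Tr: "hecke_trace Tr"
begin

lemma trace_add:
  "m \<ge> 1 \<Longrightarrow> x \<in> carrier (free_alg m) \<Longrightarrow> y \<in> carrier (free_alg m) \<Longrightarrow>
   Tr m (hecke_of m (x + y)) = Tr m (hecke_of m x) + Tr m (hecke_of m y)"
  using Tr unfolding hecke_trace_def by (metis hecke_of_add hecke_of_closed)

lemma trace_scale:
  "m \<ge> 1 \<Longrightarrow> x \<in> carrier (free_alg m) \<Longrightarrow>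
   Tr m (hecke_of m (K_const c * x)) = c * Tr m (hecke_of m x)"
  using Tr unfolding hecke_trace_def by (metis hscale_hecke_of hecke_of_closed)

lemma trace_one: "m \<ge> 1 \<Longrightarrow> Tr m (hecke_of m 1) = 1"
  using Tr unfolding hecke_trace_def by (metis hecke_of_one)

lemma trace_incl:
  "m \<ge> 1 \<Longrightarrow> x \<in> carrier (free_alg m) \<Longrightarrow> Tr (m + 1) (hecke_of (m + 1) x) = Tr m (hecke_of m x)"
  using Tr unfolding hecke_trace_def by (metis hecke_incl_hecke_of hecke_of_closed)

lemma free_alg_carrier_mono: "x \<in> carrier (free_alg m) \<Longrightarrow> x \<in> carrier (free_alg (m + 1))"
  by (fastforce simp: free_alg_def)

lemma trace_Markov:
  assumes m: "m \<ge> 1" and x: "x \<in> carrier (free_alg m)" and y: "y \<in> carrier (free_alg m)"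
  shows "Tr (m + 1) (hecke_of (m + 1) (x * free_gen m * y)) = K_z * Tr m (hecke_of m (x * y))"
proof -
  have "free_gen m \<in> carrier (free_alg (m + 1))"
    using m by (simp add: free_gen_carrier)
  then have "hecke_incl m (hecke_of m x) \<otimes>\<^bsub>hecke (m + 1)\<^esub> hT (m + 1) m
      \<otimes>\<^bsub>hecke (m + 1)\<^esub> hecke_incl m (hecke_of m y) = hecke_of (m + 1) (x * free_gen m * y)"
    using free_alg_carrier_mono[OF x] free_alg_carrier_mono[OF y]
    by (simp only: hecke_incl_hecke_of x y hT_def hecke_of_mult mult_carrier)
  moreover have "hecke_of m x \<otimes>\<^bsub>hecke m\<^esub> hecke_of m y = hecke_of m (x * y)"
    by (rule hecke_of_mult[OF x y])
  ultimately show ?thesis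
    using Tr m x y hecke_of_closed unfolding hecke_trace_def by metis
qed

text \<open>T_1 gets its value from the Markov rule on one strand and keeps it under inclusion; each
  word with a T_2 contains it exactly once, so the Markov rule on two strands removes it and leaves
  1 or T_1.\<close>

lemma trace_H3_free:
  "Tr 3 (hecke_of 3 (H3_free B0)) = 1"
  "Tr 3 (hecke_of 3 (H3_free B1)) = K_z"
  "Tr 3 (hecke_of 3 (H3_free B2)) = K_z"
  "Tr 3 (hecke_of 3 (H3_free B12)) = K_z ^ 2"
  "Tr 3 (hecke_of 3 (H3_free B21)) = K_z ^ 2"
proof -
  have T1: "free_gen 1 \<in> carrier (free_alg 2)"
    by (simp add: free_gen_carrier)
  have Tr_T1: "Tr 2 (hecke_of 2 (free_gen 1)) = K_z"
    using trace_Markov[of 1 1 1] trace_one[of 1] by (simp add: one_carrier numeral_2_eq_2)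
  have m: "2 + 1 = (3::nat)" by simp
  note M = trace_Markov[of 2, unfolded m]
  show "Tr 3 (hecke_of 3 (H3_free B0)) = 1"
    by (simp add: trace_one)
  show "Tr 3 (hecke_of 3 (H3_free B1)) = K_z"
    using trace_incl[of 2 "free_gen 1", unfolded m] T1 Tr_T1 by simp
  show "Tr 3 (hecke_of 3 (H3_free B2)) = K_z"
    using M[of 1 1] by (simp add: one_carrier trace_one)
  show "Tr 3 (hecke_of 3 (H3_free B12)) = K_z ^ 2"
    using M[of "free_gen 1" 1] T1 Tr_T1 by (simp add: one_carrier power2_eq_square)
  show "Tr 3 (hecke_of 3 (H3_free B21)) = K_z ^ 2"
    using M[of 1 "free_gen 1"] T1 Tr_T1 by (simp add: one_carrier power2_eq_square)
qed

lemma trace_H3_comb: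
  assumes "c B121 = 0"
  shows "Tr 3 (H3_comb c) = c B0 + (c B1 + c B2) * K_z + (c B12 + c B21) * K_z ^ 2"
proof -
  have "Tr 3 (H3_comb c) = c B0 * Tr 3 (hecke_of 3 (H3_free B0)) + c B1 * Tr 3 (hecke_of 3 (H3_free B1))
     + c B2 * Tr 3 (hecke_of 3 (H3_free B2)) + c B12 * Tr 3 (hecke_of 3 (H3_free B12))
     + c B21 * Tr 3 (hecke_of 3 (H3_free B21)) + c B121 * Tr 3 (hecke_of 3 (H3_free B121))"
    unfolding H3_comb_eq H3_free_comb_def
    by (simp only: trace_add trace_scale free_carrier H3_free_carrier one_le_numeral)
  then show ?thesis
    by (simp only: trace_H3_free assms) (simp add: algebra_simps)
qed

end

section \<open>Substitution in rational functions\<close>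

context
  fixes x y :: "complex poly fract"
begin

lemma const_fract_hom:
  "Fraction_Field.Fract [:0:] 1 = (0 :: complex poly fract)"
  "Fraction_Field.Fract [:a + b:] 1 = (Fraction_Field.Fract [:a:] 1 + Fraction_Field.Fract [:b:] 1 :: complex poly fract)"
  "Fraction_Field.Fract [:a * b:] 1 = (Fraction_Field.Fract [:a:] 1 * Fraction_Field.Fract [:b:] 1 :: complex poly fract)"
  by (simp_all add: Zero_fract_def mult.commute)

lemma qz_poly_subst_pCons:
  "qz_poly_subst x y (pCons c p)
     = poly (map_poly (\<lambda>a. Fraction_Field.Fract [:a:] 1) c) x + y * qz_poly_subst x y p"
  by (simp add: qz_poly_subst_def poly_map_poly_pCons)

lemma qz_poly_subst_0 [simp]: "qz_poly_subst x y 0 = 0"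
  by (simp add: qz_poly_subst_def)

lemma qz_poly_subst_add:
  "qz_poly_subst x y (p + r) = qz_poly_subst x y p + qz_poly_subst x y r"
  unfolding qz_poly_subst_def
  by (rule poly_map_poly_add) (simp, rule poly_map_poly_add, rule const_fract_hom, rule const_fract_hom)

text \<open>Constants embed as a ring, hence evaluation of the coefficients at \<open>x\<close> is a
  homomorphism, hence so is the outer evaluation at \<open>y\<close>.\<close>

lemma qz_poly_subst_mult:
  "qz_poly_subst x y (p * r) = qz_poly_subst x y p * qz_poly_subst x y r"
  unfolding qz_poly_subst_def
  by (rule poly_map_poly_mult)
     (simp, (rule poly_map_poly_add poly_map_poly_mult; rule const_fract_hom)+)

lemma qz_poly_subst_const:
  "qz_poly_subst x y [:[:a:]:] = Fraction_Field.Fract [:a:] 1"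
  by (simp add: qz_poly_subst_pCons poly_map_poly_pCons flip: Zero_fract_def)

lemma qz_poly_subst_1 [simp]: "qz_poly_subst x y 1 = 1"
  using qz_poly_subst_const[of 1] by (simp add: one_pCons[symmetric] One_fract_def)

text \<open>The graph of evaluation on the local ring of fractions defined at the point
  (\<open>x\<close>, \<open>y\<close>). As a relation it composes along expressions without appeal
  to a definite description.\<close>

definition subst_rel :: "qz_field \<Rightarrow> complex poly fract \<Rightarrow> bool" where
  "subst_rel f r \<longleftrightarrow>
     (\<exists>a b. qz_poly_subst x y b \<noteq> 0 \<and> f = Fraction_Field.Fract a b
        \<and> r = qz_poly_subst x y a / qz_poly_subst x y b)"

lemma subst_relI:
  "qz_poly_subst x y b \<noteq> 0 \<Longrightarrow>
   subst_rel (Fraction_Field.Fract a b) (qz_poly_subst x y a / qz_poly_subst x y b)"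
  unfolding subst_rel_def by blast

lemma subst_relE:
  assumes "subst_rel f r"
  obtains a b where "qz_poly_subst x y b \<noteq> 0" "b \<noteq> 0" "f = Fraction_Field.Fract a b"
    "r = qz_poly_subst x y a / qz_poly_subst x y b"
  using assms unfolding subst_rel_def by (metis qz_poly_subst_0)

text \<open>Equal fractions give equal cross products, evaluation preserves these, and the
  denominators keep nonzero values, so the quotients agree.\<close>

lemma subst_rel_unique: "subst_rel f r \<Longrightarrow> subst_rel f s \<Longrightarrow> r = s"
proof (elim subst_relE)
  fix a b c d
  assume *: "qz_poly_subst x y b \<noteq> 0" "qz_poly_subst x y d \<noteq> 0" "b \<noteq> 0" "d \<noteq> 0"
    "f = Fraction_Field.Fract a b" "f = Fraction_Field.Fract c d"
    "r = qz_poly_subst x y a / qz_poly_subst x y b" "s = qz_poly_subst x y c / qz_poly_subst x y d"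
  then have "a * d = c * b" by (simp add: eq_fract)
  then have "qz_poly_subst x y a * qz_poly_subst x y d = qz_poly_subst x y c * qz_poly_subst x y b"
    by (simp flip: qz_poly_subst_mult)
  with * show "r = s" by (simp add: frac_eq_eq)
qed

lemma qz_subst_eq: "subst_rel f r \<Longrightarrow> qz_subst x y f = r"
  unfolding qz_subst_def subst_rel_def[symmetric]
  by (rule the_equality) (auto intro: subst_rel_unique)

lemma subst_rel_add:
  assumes "subst_rel f r" "subst_rel g s"
  shows "subst_rel (f + g) (r + s)"
proof -
  obtain a b where ab: "qz_poly_subst x y b \<noteq> 0" "b \<noteq> 0" "f = Fraction_Field.Fract a b"
    "r = qz_poly_subst x y a / qz_poly_subst x y b" using assms(1) by (rule subst_relE)
  obtain c d where cd: "qz_poly_subst x y d \<noteq> 0" "d \<noteq> 0" "g = Fraction_Field.Fract c d"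
    "s = qz_poly_subst x y c / qz_poly_subst x y d" using assms(2) by (rule subst_relE)
  show ?thesis
    using subst_relI[of "b * d" "a * d + c * b"] ab cd
    by (simp add: qz_poly_subst_add qz_poly_subst_mult add_frac_eq)
qed

lemma subst_rel_mult:
  assumes "subst_rel f r" "subst_rel g s"
  shows "subst_rel (f * g) (r * s)"
proof -
  obtain a b where ab: "qz_poly_subst x y b \<noteq> 0" "b \<noteq> 0" "f = Fraction_Field.Fract a b"
    "r = qz_poly_subst x y a / qz_poly_subst x y b" using assms(1) by (rule subst_relE)
  obtain c d where cd: "qz_poly_subst x y d \<noteq> 0" "d \<noteq> 0" "g = Fraction_Field.Fract c d"
    "s = qz_poly_subst x y c / qz_poly_subst x y d" using assms(2) by (rule subst_relE)
  show ?thesis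
    using subst_relI[of "b * d" "a * c"] ab cd by (simp add: qz_poly_subst_mult)
qed

text \<open>A nonzero value means that the numerator does not vanish at the point, so it may become
  the denominator.\<close>

lemma subst_rel_inverse:
  assumes "subst_rel f r" "r \<noteq> 0"
  shows "subst_rel (inverse f) (inverse r)"
  using assms(1)
proof (rule subst_relE)
  fix a b assume "qz_poly_subst x y b \<noteq> 0" "f = Fraction_Field.Fract a b"
    "r = qz_poly_subst x y a / qz_poly_subst x y b"
  then show ?thesis
    using subst_relI[of a b] assms(2) by simp
qed

lemma subst_rel_divide:
  "subst_rel f r \<Longrightarrow> subst_rel g s \<Longrightarrow> s \<noteq> 0 \<Longrightarrow> subst_rel (f / g) (r / s)"
  unfolding divide_inverse by (intro subst_rel_mult subst_rel_inverse)

lemma subst_rel_of_int: "subst_rel (of_int k) (of_int k)"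
  using subst_relI[of 1 "[:[:of_int k:]:]"] qz_poly_subst_const[of "of_int k"]
  by (simp add: of_int_fract of_int_poly)

lemma subst_rel_1: "subst_rel 1 1"
  using subst_rel_of_int[of 1] by simp

lemma subst_rel_diff:
  assumes "subst_rel f r" "subst_rel g s"
  shows "subst_rel (f - g) (r - s)"
  using subst_rel_add[OF assms(1) subst_rel_mult[OF subst_rel_of_int[of "-1"] assms(2)]] by simp

lemma subst_rel_power: "subst_rel f r \<Longrightarrow> subst_rel (f ^ k) (r ^ k)"
  by (induction k) (auto intro: subst_rel_1 subst_rel_mult)

lemma subst_rel_power_int: "subst_rel f r \<Longrightarrow> r \<noteq> 0 \<Longrightarrow> subst_rel (f powi k) (r powi k)"
  by (simp add: power_int_def subst_rel_power subst_rel_inverse)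

lemma subst_rel_int_poly_at: "subst_rel f r \<Longrightarrow> subst_rel (int_poly_at p f) (int_poly_at p r)"
proof (induction p)
  case 0
  then show ?case using subst_rel_of_int[of 0] by simp
qed (auto simp: int_poly_at_pCons intro: subst_rel_add subst_rel_mult subst_rel_of_int)

lemma subst_rel_K_q: "subst_rel K_q x"
  using subst_relI[of 1 "[:[:0, 1:]:]"]
  by (simp add: K_q_def qz_poly_subst_pCons poly_map_poly_pCons Zero_fract_def[symmetric] One_fract_def[symmetric]
      one_pCons[symmetric])

lemma subst_rel_K_z: "subst_rel K_z y"
  using subst_relI[of 1 "[:0, 1:]"] qz_poly_subst_1
  by (simp add: K_z_def qz_poly_subst_pCons[of 0] flip: one_pCons)

end

section \<open>The Jones polynomial of $W(3,n)$\<close>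

lemma t_var_nonzero: "t_var \<noteq> 0" "1 + t_var \<noteq> 0"
  by (simp_all add: t_var_def Zero_fract_def One_fract_def eq_fract one_pCons)

theorem mainTheorem5:
  fixes n :: nat
    and Tr :: "nat \<Rightarrow> free_elt set \<Rightarrow> qz_field"
  assumes "n \<ge> 1" and "gcd 3 n = 1"
    and "hecke_trace Tr"
  shows "jones_closure Tr 3 (weaving_braid n) =
    t_var powi (- int n - 1) *
      ((1 + t_var) ^ 2 * int_poly_at (weaving_C n B0) t_var
       + (1 + t_var) * (int_poly_at (weaving_C n B1) t_var + int_poly_at (weaving_C n B2) t_var)
           * t_var ^ 2
       + (int_poly_at (weaving_C n B12) t_var + int_poly_at (weaving_C n B21) t_var) * t_var ^ 4)"
proof -
  define y where "y = t_var ^ 2 / (1 + t_var)"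
  note t = t_var_nonzero
  let ?C = "\<lambda>b. int_poly_at (weaving_C n b)"
  \<comment> \<open>The value of w is found from (1 - t)(1 + t) + t^2 = 1.\<close>
  have y: "y \<noteq> 0" and w: "1 - t_var + y = 1 / (1 + t_var)" "1 / (1 + t_var) \<noteq> 0"
    using t by (simp_all add: y_def field_simps power2_eq_square)
  have "Tr 3 (braid_rep 3 (weaving_braid n)) = K_q powi (- int n) *
      (?C B0 K_q + (?C B1 K_q + ?C B2 K_q) * K_z + (?C B12 K_q + ?C B21 K_q) * K_z ^ 2)"
    unfolding braid_rep_weaving_braid weaving_power hscale_H3_comb weaving_C_eq
    by (subst trace_H3_comb[OF assms(3)]) (simp_all add: weaving_coeff_shape(1) algebra_simps)
  \<comment> \<open>Three strands mean N = 2, so the parity test succeeds and both exponents are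
    1.\<close>
  then have V: "V_braid Tr 3 (weaving_braid n) = 1 / K_z * (K_q / K_w) * (K_q powi (- int n) *
      (?C B0 K_q + (?C B1 K_q + ?C B2 K_q) * K_z + (?C B12 K_q + ?C B21 K_q) * K_z ^ 2))"
    by (simp add: V_braid_def Let_def exponent_sum_weaving_braid)
  have K_w: "subst_rel t_var y K_w (1 / (1 + t_var))"
    unfolding K_w_def w(1)[symmetric]
    by (intro subst_rel_add subst_rel_diff subst_rel_1 subst_rel_K_q subst_rel_K_z)
  \<comment> \<open>The side conditions are nonvanishing values: y for z, 1/(1+t) for w, and t for
    the integer power of q.\<close>
  have "subst_rel t_var y (V_braid Tr 3 (weaving_braid n))
      (1 / y * (t_var / (1 / (1 + t_var))) * (t_var powi (- int n) *
        (?C B0 t_var + (?C B1 t_var + ?C B2 t_var) * y + (?C B12 t_var + ?C B21 t_var) * y ^ 2)))"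
    unfolding V
    by (intro subst_rel_add subst_rel_mult subst_rel_divide subst_rel_power subst_rel_power_int
        subst_rel_int_poly_at subst_rel_1 subst_rel_K_q subst_rel_K_z K_w y w(2) t)
  then have "jones_closure Tr 3 (weaving_braid n)
    = 1 / y * (t_var / (1 / (1 + t_var))) * (t_var powi (- int n) *
        (?C B0 t_var + (?C B1 t_var + ?C B2 t_var) * y + (?C B12 t_var + ?C B21 t_var) * y ^ 2))"
    unfolding jones_closure_def y_def[symmetric] by (rule qz_subst_eq)
  \<comment> \<open>The prefactor t (1+t) / y equals (1+t)^2 / t; times 1, y and y^2 it yields
    (1+t)^2, (1+t) t^2 and t^4, each over t.\<close>
  also have "\<dots> = t_var powi (- int n) / t_var *
      ((1 + t_var) ^ 2 * ?C B0 t_var + (1 + t_var) * (?C B1 t_var + ?C B2 t_var) * t_var ^ 2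
       + (?C B12 t_var + ?C B21 t_var) * t_var ^ 4)"
  proof -
    \<comment> \<open>As an atom, 1 + t is not expanded by the field arithmetic.\<close>
    define u where "u = 1 + t_var"
    have u: "u \<noteq> 0" and y': "y = t_var ^ 2 / u"
      using t by (simp_all add: u_def y_def)
    show ?thesis
      unfolding u_def[symmetric] y' using t(1) u
      by (simp add: field_simps power2_eq_square eval_nat_numeral)
  qed
  also have "t_var powi (- int n) / t_var = t_var powi (- int n - 1)"
    using t(1) by (simp add: power_int_diff)
  finally show ?thesis .
qed

end
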